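(* Let $n$ be a positive integer, $h_0,\dots,h_{n-1}\in H_b$ and $c_0,\dots,c_{n-1}\in\mathbb{R}$. Put $f_0\equiv0$ and, for $1\le k\le n$, define functions $f_k$ on $D$ recursively by $$f_k(z)=ic_{k-1}-I_{k-1}+\frac1{2\pi}\langle(h_{k-1})_b,P_r(\theta-\cdot)\rangle-\sum_{\ell=1}^{k-1}\frac{(-1)^\ell}{\ell!}\,\bar z^\ell f_{k-\ell}(z),\qquad z=re^{i\theta},$$ where $$I_{k-1}=\frac{i}{2\pi}\langle\operatorname{Im}\{(h_{k-1})_b\},1\rangle,\qquad P_r(\theta)=\frac{1-r^2}{1-2r\cos\theta+r^2}.$$ Then for each $1\le k\le n$, $f_k$ solves the Schwarz problem $$\frac{\partial f_k}{\partial\bar z}=f_{k-1},\qquad \operatorname{Re}\{(f_k)_b\}=\operatorname{Re}\left\{(h_{k-1})_b-\sum_{\ell=1}^{k-1}\frac{(-1)^\ell}{\ell!}e^{-i\ell(\cdot)}(f_{k-\ell})_b\right\},\qquad \operatorname{Im}\{f_k(0)\}=c_{k-1},$$ and $f_n$ solves the Schwarz problem $$\frac{\partial^nf_n}{\partial\bar z^n}=0,$$ $$\operatorname{Re}\left\{\left(\frac{\partial^kf_n}{\partial\bar z^k}\right)_b\right\}=\operatorname{Re}\{(f_{n-k})_b\}=\operatorname{Re}\left\{(h_{n-1-k})_b-\sum_{\ell=1}^{n-k-1}\frac{(-1)^\ell}{\ell!}e^{-i\ell(\cdot)}(f_{n-k-\ell})_b\right\},\quad 0\le k\le n-1,$$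 $$\operatorname{Im}\left\{\frac{\partial^kf_n}{\partial\bar z^k}(0)\right\}=c_{n-1-k},\quad 0\le k\le n-1.$$
   Context: $D$ is the open unit disk in $\mathbb{C}$, $\partial D$ is the unit circle, $H(D)$ is the space of holomorphic functions on $D$, and $\mathcal{D}'(\partial D)$ is the space of distributions on $\partial D$. Functions $\varphi\in C^\infty(\partial D)$ are identified with smooth $2\pi$-periodic functions of $\theta$; $e^{-i\ell(\cdot)}$ denotes the smooth function $t\mapsto e^{-i\ell t}$, and the product of a distribution $u$ with a smooth function $\psi$ is $\langle\psi u,\varphi\rangle=\langle u,\psi\varphi\rangle$. Boundary value in the sense of distributions: a function $g$ on $D$ has a boundary value in the sense of distributions, denoted $g_b\in\mathcal{D}'(\partial D)$, if for every $\varphi\in C^\infty(\partial D)$ the limit $$\langle g_b,\varphi\rangle:=\lim_{r\nearrow1}\int_0^{2\pi}g(re^{i\theta})\,\varphi(\theta)\,d\theta$$ exists. $H_b$ is the set of functions in $H(D)$ that have a boundary value in the sense of distributions. For a distribution $u$, $\operatorname{Re}u$ and $\operatorname{Im}u$ are the real-valued distributions with $u=\operatorname{Re}u+i\operatorname{Im}u$, i.e. $\langle\operatorname{Re}u,\varphi\rangle=\operatorname{Re}\langle u,\varphi\rangle$ and $\langle\operatorname{Im}u,\varphi\rangle=\operatorname{Im}\langle u,\varphi\rangle$ for real-valued $\varphi$. *)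

theory Defs
  imports "HOL-Complex_Analysis.Complex_Analysis"
begin

subsection \<open>Test functions and distributions on the unit circle\<close>

definition vderiv :: "nat \<Rightarrow> (real \<Rightarrow> complex) \<Rightarrow> real \<Rightarrow> complex" where
  "vderiv k = ((\<lambda>\<phi> t. vector_derivative \<phi> (at t)) ^^ k)"

text \<open>Smooth functions on the circle are smooth \<open>2\<pi>\<close>-periodic functions of the angle.\<close>

definition circle_test :: "(real \<Rightarrow> complex) set" where
  "circle_test = {\<phi>. (\<forall>k t. vderiv k \<phi> differentiable (at t)) \<and> (\<forall>t. \<phi> (t + 2 * pi) = \<phi> t)}"

text \<open>
  A distribution is represented by a functional on all functions \<open>real \<Rightarrow> complex\<close>; only its values
  on \<open>circle_test\<close> are meaningful, and equality of distributions is \<open>distr_eq\<close>. Continuity is with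
  respect to the seminorms \<open>sup \<bar>\<phi>\<^sup>(\<^sup>j\<^sup>)\<bar>\<close> of the Frechet space of smooth functions on the circle.
\<close>

type_synonym functional = "(real \<Rightarrow> complex) \<Rightarrow> complex"

definition circle_distributions :: "functional set" where
  "circle_distributions = {u.
     (\<forall>\<phi>\<in>circle_test. \<forall>\<psi>\<in>circle_test. u (\<lambda>t. \<phi> t + \<psi> t) = u \<phi> + u \<psi>) \<and>
     (\<forall>\<phi>\<in>circle_test. \<forall>a. u (\<lambda>t. a * \<phi> t) = a * u \<phi>) \<and>
     (\<exists>N C. \<forall>\<phi>\<in>circle_test. cmod (u \<phi>) \<le> C * (\<Sum>j\<le>N. SUP t\<in>{0..2*pi}. cmod (vderiv j \<phi> t)))}"

definition distr_eq :: "functional \<Rightarrow> functional \<Rightarrow> bool" where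
  "distr_eq u v \<longleftrightarrow> (\<forall>\<phi>\<in>circle_test. u \<phi> = v \<phi>)"

definition distr_mult :: "(real \<Rightarrow> complex) \<Rightarrow> functional \<Rightarrow> functional" where
  "distr_mult \<psi> u = (\<lambda>\<phi>. u (\<lambda>t. \<psi> t * \<phi> t))"

text \<open>
  On real-valued test functions these are \<open>Re (u \<phi>)\<close> and \<open>Im (u \<phi>)\<close>; they are extended
  complex-linearly to complex-valued test functions.
\<close>

definition distr_Re :: "functional \<Rightarrow> functional" where
  "distr_Re u = (\<lambda>\<phi>. of_real (Re (u (\<lambda>t. of_real (Re (\<phi> t)))))
                   + \<i> * of_real (Re (u (\<lambda>t. of_real (Im (\<phi> t))))))"

definition distr_Im :: "functional \<Rightarrow> functional" where
  "distr_Im u = (\<lambda>\<phi>. of_real (Im (u (\<lambda>t. of_real (Re (\<phi> t)))))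
                   + \<i> * of_real (Im (u (\<lambda>t. of_real (Im (\<phi> t))))))"


subsection \<open>Boundary values in the sense of distributions\<close>

definition circle_pairing :: "(complex \<Rightarrow> complex) \<Rightarrow> (real \<Rightarrow> complex) \<Rightarrow> real \<Rightarrow> complex" where
  "circle_pairing g \<phi> r = integral {0..2*pi} (\<lambda>\<theta>. g (of_real r * exp (\<i> * of_real \<theta>)) * \<phi> \<theta>)"

text \<open>
  The integrability clause makes the integrals meaningful for arbitrary \<open>g\<close> (the value of \<open>integral\<close> is
  0 otherwise); it holds automatically for \<open>g\<close> continuous on the disk.
\<close>

definition has_boundary_value :: "(complex \<Rightarrow> complex) \<Rightarrow> bool" where
  "has_boundary_value g \<longleftrightarrow> (\<forall>\<phi>\<in>circle_test.
     (\<forall>\<^sub>F r in at_left 1.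
        (\<lambda>\<theta>. g (of_real r * exp (\<i> * of_real \<theta>)) * \<phi> \<theta>) absolutely_integrable_on {0..2*pi}) \<and>
     (\<exists>L. (circle_pairing g \<phi> \<longlongrightarrow> L) (at_left 1)))"

definition boundary_value :: "(complex \<Rightarrow> complex) \<Rightarrow> functional" where
  "boundary_value g = (\<lambda>\<phi>. Lim (at_left 1) (circle_pairing g \<phi>))"

definition H_b :: "(complex \<Rightarrow> complex) set" where
  "H_b = {g. g holomorphic_on ball 0 1 \<and> has_boundary_value g}"


subsection \<open>The Wirtinger derivative with respect to the conjugate variable\<close>

text \<open>
  With the real Frechet derivative \<open>A\<close> of \<open>f\<close> at \<open>z\<close>, \<open>A 1\<close> and \<open>A \<i>\<close> are the partial derivatives
  in \<open>x\<close> and in \<open>y\<close>. The value is only meaningful where \<open>f\<close> is real differentiable.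
\<close>

definition dbar :: "(complex \<Rightarrow> complex) \<Rightarrow> complex \<Rightarrow> complex" where
  "dbar f z = (frechet_derivative f (at z) 1 + \<i> * frechet_derivative f (at z) \<i>) / 2"


subsection \<open>The recursively defined functions\<close>

definition poisson_kernel :: "real \<Rightarrow> real \<Rightarrow> real" where
  "poisson_kernel r \<theta> = (1 - r^2) / (1 - 2 * r * cos \<theta> + r^2)"

definition I_const :: "(complex \<Rightarrow> complex) \<Rightarrow> complex" where
  "I_const g = \<i> / (2 * pi) * distr_Im (boundary_value g) (\<lambda>_. 1)"

text \<open>
  The polar representation of \<open>z\<close> used is \<open>r = \<bar>z\<bar>\<close>, \<open>\<theta> = Arg z\<close>; since \<open>poisson_kernel r\<close> is
  \<open>2\<pi>\<close>-periodic and \<open>poisson_kernel 0\<close> is constant, any other choice of the angle gives the same value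
  (lemma \<open>schwarz_fun_polar\<close>). Only the values on the unit disk are relevant.
\<close>

fun schwarz_fun ::
  "(nat \<Rightarrow> complex \<Rightarrow> complex) \<Rightarrow> (nat \<Rightarrow> real) \<Rightarrow> nat \<Rightarrow> complex \<Rightarrow> complex" where
  "schwarz_fun h c 0 z = 0"
| "schwarz_fun h c (Suc k) z =
     \<i> * c k - I_const (h k)
     + 1 / (2 * pi) * boundary_value (h k) (\<lambda>t. of_real (poisson_kernel (cmod z) (Arg z - t)))
     - (\<Sum>l=1..k. (-1) ^ l / fact l * cnj z ^ l * schwarz_fun h c (Suc k - l) z)"

lemma schwarz_fun_polar:
  fixes r \<theta> :: real
  assumes "r \<ge> 0" and z: "z = of_real r * exp (\<i> * of_real \<theta>)" and k: "k \<ge> 1"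
  shows "schwarz_fun h c k z =
     \<i> * c (k - 1) - I_const (h (k - 1))
     + 1 / (2 * pi) * boundary_value (h (k - 1)) (\<lambda>t. of_real (poisson_kernel r (\<theta> - t)))
     - (\<Sum>l=1..k-1. (-1) ^ l / fact l * cnj z ^ l * schwarz_fun h c (k - l) z)"
proof -
  have r: "cmod z = r"
    using assms by (simp add: norm_mult)
  have "poisson_kernel r (Arg z - t) = poisson_kernel r (\<theta> - t)" for t
  proof (cases "r = 0")
    case False
    have "z \<noteq> 0" using False r by auto
    have "of_real r * cis (Arg z) = of_real r * cis \<theta>"
      using rcis_cmod_Arg[of z] r z by (simp add: rcis_def cis_conv_exp)
    hence "cis (Arg z) = cis \<theta>" using False by simp
    hence "cos (Arg z) = cos \<theta>" "sin (Arg z) = sin \<theta>" by (simp_all add: complex_eq_iff)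
    thus ?thesis by (simp add: poisson_kernel_def cos_diff)
  qed (simp add: poisson_kernel_def)
  moreover obtain m where "k = Suc m" using k by (cases k) auto
  ultimately show ?thesis using r by simp
qed

end

(*
  Let a_m be the Taylor coefficients of h in H_b. For a test function phi the pairing on the circle of
  radius r is the sum of a_m r^m F_m(phi), where F_m(phi) is the integral of exp(i m t) phi(t). Applied to
  the Poisson kernel, for which F_m = 2 pi z^m, this gives that the Poisson integral of h_b is h, so
    f_k = h_{k-1} + i (c_{k-1} - Im h_{k-1}(0)) - sum_{l=1}^{k-1} (-1)^l / l! (conj z)^l f_{k-l}
  on the disk. The product rule and induction on k then give dbar f_k = f_{k-1}, and boundary values can be
  taken term by term, where (conj z)^l turns into the character exp(-i l t). The boundary value of h is
  continuous on test functions because its existence forces a_m to grow at most polynomially, whereas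
  F_m(phi) decreases rapidly.
*)
theory Submission
  imports Defs
begin

subsection \<open>Test functions\<close>

text \<open>Generating functions explain the coefficients: for F(s) = sum f_k s^k the recursion says
  that exp(-s conj z) F(s) has holomorphic coefficients, so dbar F = s F, which is dbar f_k =
  f_{k-1}. Subtracting I_{k-1} strips Im h_{k-1}(0), so that c_{k-1} can be prescribed; the
  resulting imaginary constant is invisible to the real part of the boundary value. The analytic
  obstacle is that the limits defining h_b exist for each test function separately, while a
  distribution needs one bound for all of them. The uniform boundedness argument is carried out on
  the Taylor coefficients, with a single test function built against them. Moreover h_b may only be
  evaluated at smooth functions, so the Poisson kernel has to be recognised as a rapidly converging
  trigonometric series, of which only the frequencies at most 0 interact with h.\<close>

lemma vderiv_0 [simp]: "vderiv 0 \<phi> = \<phi>"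
  by (simp add: vderiv_def)

lemma vderiv_Suc: "vderiv (Suc k) \<phi> t = vector_derivative (vderiv k \<phi>) (at t)"
  by (simp add: vderiv_def)

lemma vderiv_add_index: "vderiv j (vderiv k \<phi>) = vderiv (j + k) \<phi>"
  by (simp add: vderiv_def funpow_add)

text \<open>Smoothness is always shown by exhibiting the whole sequence \<open>G\<close> of
  derivatives at once; uniqueness of derivatives identifies it with the iterates of the choice
  operator \<open>vector_derivative\<close>.\<close>

lemma vderiv_eqI:
  assumes "\<And>t. G 0 t = \<phi> t"
    and "\<And>k t. (G k has_vector_derivative G (Suc k) t) (at t)"
  shows "vderiv k \<phi> = G k"
proof (induction k)
  case 0
  then show ?case using assms(1) by auto
next
  case (Suc k)
  then show ?case
    using vector_derivative_at[OF assms(2)[of k]] by (intro ext) (simp add: vderiv_Suc)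
qed

lemma circle_testI:
  assumes "\<And>t. G 0 t = \<phi> t"
    and "\<And>k t. (G k has_vector_derivative G (Suc k) t) (at t)"
    and "\<And>t. \<phi> (t + 2 * pi) = \<phi> t"
  shows "\<phi> \<in> circle_test"
  unfolding circle_test_def mem_Collect_eq vderiv_eqI[of G \<phi>, OF assms(1,2)]
  using differentiableI_vector[OF assms(2)] assms(3) by blast

lemma circle_test_periodic: "\<phi> \<in> circle_test \<Longrightarrow> \<phi> (t + 2 * pi) = \<phi> t"
  by (simp add: circle_test_def)

lemma circle_test_vderiv:
  "\<phi> \<in> circle_test \<Longrightarrow> (vderiv k \<phi> has_vector_derivative vderiv (Suc k) \<phi> t) (at t)"
  by (simp add: circle_test_def vderiv_Suc vector_derivative_works)

lemma circle_test_derivative: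
  "\<phi> \<in> circle_test \<Longrightarrow> (\<phi> has_vector_derivative vderiv 1 \<phi> t) (at t)"
  using circle_test_vderiv[of \<phi> 0 t] by simp

lemma vderiv_periodic:
  assumes "\<phi> \<in> circle_test"
  shows "vderiv k \<phi> (t + 2 * pi) = vderiv k \<phi> t"
proof (induction k arbitrary: t)
  case 0
  then show ?case using assms by (simp add: circle_test_periodic)
next
  case (Suc k)
  \<comment> \<open>The chain rule for the shift by one period; the induction hypothesis turns the
    shifted function back into \<open>vderiv k \<phi>\<close>, and uniqueness of derivatives
    concludes.\<close>
  have "((\<lambda>s. vderiv k \<phi> (s + 2 * pi)) has_vector_derivative vderiv (Suc k) \<phi> (t + 2 * pi)) (at t)"
    using vector_diff_chain_at[of "\<lambda>s. s + 2 * pi" 1 t "vderiv k \<phi>" "vderiv (Suc k) \<phi> (t + 2 * pi)"]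
      circle_test_vderiv[OF assms, of k "t + 2 * pi"]
      has_vector_derivative_add[OF has_vector_derivative_id has_vector_derivative_const[of "2 * pi"]]
    by (simp add: o_def)
  then have "(vderiv k \<phi> has_vector_derivative vderiv (Suc k) \<phi> (t + 2 * pi)) (at t)"
    by (simp add: Suc.IH)
  then show ?case
    using circle_test_vderiv[OF assms, of k t] vector_derivative_unique_at by blast
qed

lemma vderiv_in_circle_test: "\<phi> \<in> circle_test \<Longrightarrow> vderiv k \<phi> \<in> circle_test"
  by (rule circle_testI[where G = "\<lambda>j. vderiv (j + k) \<phi>"])
    (auto simp: vderiv_periodic circle_test_vderiv)

lemma continuous_on_vderiv: "\<phi> \<in> circle_test \<Longrightarrow> continuous_on A (vderiv k \<phi>)"
  by (meson circle_test_vderiv continuous_at_imp_continuous_on has_vector_derivative_continuous)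

lemma continuous_on_circle_test: "\<phi> \<in> circle_test \<Longrightarrow> continuous_on A \<phi>"
  using continuous_on_vderiv[of \<phi> A 0] by simp

lemma
  assumes "\<phi> \<in> circle_test" "\<psi> \<in> circle_test"
  shows circle_test_add: "(\<lambda>t. \<phi> t + \<psi> t) \<in> circle_test"
    and vderiv_add: "vderiv k (\<lambda>t. \<phi> t + \<psi> t) = (\<lambda>t. vderiv k \<phi> t + vderiv k \<psi> t)"
  using assms
  by (auto intro!: circle_testI[where G = "\<lambda>k t. vderiv k \<phi> t + vderiv k \<psi> t"]
      vderiv_eqI[where G = "\<lambda>k t. vderiv k \<phi> t + vderiv k \<psi> t"]
      has_vector_derivative_add circle_test_vderiv simp: circle_test_periodic)

lemma
  assumes "\<phi> \<in> circle_test"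
  shows circle_test_cmult: "(\<lambda>t. a * \<phi> t) \<in> circle_test"
    and vderiv_cmult: "vderiv k (\<lambda>t. a * \<phi> t) = (\<lambda>t. a * vderiv k \<phi> t)"
  using assms
  by (auto intro!: circle_testI[where G = "\<lambda>k t. a * vderiv k \<phi> t"]
      vderiv_eqI[where G = "\<lambda>k t. a * vderiv k \<phi> t"]
      has_vector_derivative_mult_right circle_test_vderiv simp: circle_test_periodic)

text \<open>Real linearity of \<open>L\<close> is the point: Re and Im are not complex linear, and
  \<open>distr_Re\<close> and \<open>distr_Im\<close> evaluate functionals at the real and imaginary
  parts of test functions.\<close>

lemma circle_test_bounded_linear:
  assumes "\<phi> \<in> circle_test" "bounded_linear L"
  shows "(\<lambda>t. L (\<phi> t)) \<in> circle_test"
proof (rule circle_testI[where G = "\<lambda>k t. L (vderiv k \<phi> t)"])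
  show "((\<lambda>t. L (vderiv k \<phi> t)) has_vector_derivative L (vderiv (Suc k) \<phi> t)) (at t)" for k t
    by (rule bounded_linear.has_vector_derivative[OF assms(2) circle_test_vderiv[OF assms(1)]])
qed (simp_all add: circle_test_periodic[OF assms(1)])

lemma circle_test_Re: "\<phi> \<in> circle_test \<Longrightarrow> (\<lambda>t. of_real (Re (\<phi> t))) \<in> circle_test"
  using circle_test_bounded_linear[OF _ bounded_linear_compose[OF bounded_linear_of_real bounded_linear_Re]]
  by simp

lemma circle_test_Im: "\<phi> \<in> circle_test \<Longrightarrow> (\<lambda>t. of_real (Im (\<phi> t))) \<in> circle_test"
  using circle_test_bounded_linear[OF _ bounded_linear_compose[OF bounded_linear_of_real bounded_linear_Im]]
  by simp

lemma circle_test_const: "(\<lambda>t. a) \<in> circle_test"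
  by (rule circle_testI[where G = "\<lambda>k t. if k = 0 then a else 0"]) auto

section \<open>Multiplication of test functions by characters\<close>

lemma has_vector_derivative_cis_mult:
  "((\<lambda>t. cis (a * t)) has_vector_derivative \<i> * of_real a * cis (a * t)) (at t within A)"
proof -
  have cis: "cis (a * s) = exp (\<i> * of_real a * of_real s)" for s
    by (simp add: cis_conv_exp mult.assoc)
  have "((\<lambda>z. exp (\<i> * of_real a * z)) has_field_derivative
      exp (\<i> * of_real a * of_real t) * (\<i> * of_real a)) (at (of_real t))"
    by (rule DERIV_fun_exp) (rule DERIV_cmult_Id)
  from has_vector_derivative_real_field[OF this] show ?thesis
    unfolding cis by (simp only: mult.commute)
qed

text \<open>Since \<open>(cis (a t) \<phi>)' = cis (a t) (i a \<phi> + \<phi>')\<close>, multiplication by a character conjugates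
  differentiation into this operator.\<close>

definition twist :: "real \<Rightarrow> (real \<Rightarrow> complex) \<Rightarrow> real \<Rightarrow> complex" where
  "twist a \<phi> = (\<lambda>t. \<i> * of_real a * \<phi> t + vderiv 1 \<phi> t)"

lemma twist_in_circle_test: "\<phi> \<in> circle_test \<Longrightarrow> (twist a ^^ k) \<phi> \<in> circle_test"
proof (induction k)
  case (Suc k)
  then show ?case
    by (auto simp: twist_def intro!: circle_test_add circle_test_cmult vderiv_in_circle_test)
qed simp

lemma has_vector_derivative_cis_mult_test:
  assumes "\<phi> \<in> circle_test"
  shows "((\<lambda>t. cis (a * t) * \<phi> t) has_vector_derivative cis (a * t) * twist a \<phi> t) (at t)"
  unfolding twist_def
  by (rule has_vector_derivative_eq_rhs, rule has_vector_derivative_mult,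
      rule has_vector_derivative_cis_mult, rule circle_test_derivative[OF assms])
    (simp add: algebra_simps)

lemma cis_periodic:
  assumes "a \<in> \<int>"
  shows "cis (a * (t + 2 * pi)) = cis (a * t)"
proof -
  have "cis (a * (t + 2 * pi)) = cis (a * t) * cis (2 * pi * a)"
    by (simp add: cis_mult algebra_simps)
  then show ?thesis using cis_multiple_2pi[OF assms] by simp
qed

lemma
  assumes "\<phi> \<in> circle_test"
  shows circle_test_cis_mult: "a \<in> \<int> \<Longrightarrow> (\<lambda>t. cis (a * t) * \<phi> t) \<in> circle_test"
    and vderiv_cis_mult: "vderiv k (\<lambda>t. cis (a * t) * \<phi> t) = (\<lambda>t. cis (a * t) * (twist a ^^ k) \<phi> t)"
proof -
  let ?G = "\<lambda>k t. cis (a * t) * (twist a ^^ k) \<phi> t"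
  have G: "(?G k has_vector_derivative ?G (Suc k) t) (at t)" for k t
    using has_vector_derivative_cis_mult_test[OF twist_in_circle_test[OF assms]] by simp
  show "(\<lambda>t. cis (a * t) * \<phi> t) \<in> circle_test" if "a \<in> \<int>"
    by (rule circle_testI[where G = ?G, OF _ G])
      (use that assms in \<open>auto simp: cis_periodic circle_test_periodic\<close>)
  show "vderiv k (\<lambda>t. cis (a * t) * \<phi> t) = ?G k"
    by (rule vderiv_eqI[where G = ?G, OF _ G]) simp
qed

section \<open>Seminorms on the space of test functions\<close>

text \<open>The expression that bounds functionals in \<open>circle_distributions\<close>. Summing
  over all orders up to \<open>N\<close> makes it monotone in \<open>N\<close>, so bounds of
  different orders can be merged.\<close>

definition test_seminorm :: "nat \<Rightarrow> (real \<Rightarrow> complex) \<Rightarrow> real" where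
  "test_seminorm N \<phi> = (\<Sum>j\<le>N. SUP t\<in>{0..2*pi}. cmod (vderiv j \<phi> t))"

lemma bdd_above_vderiv:
  assumes "\<phi> \<in> circle_test"
  shows "bdd_above ((\<lambda>t. cmod (vderiv j \<phi> t)) ` {0..2*pi})"
  by (intro bounded_imp_bdd_above compact_imp_bounded compact_continuous_image
      continuous_intros continuous_on_vderiv assms) auto

lemma norm_vderiv_le_SUP:
  assumes "\<phi> \<in> circle_test" "t \<in> {0..2*pi}"
  shows "cmod (vderiv j \<phi> t) \<le> (SUP t\<in>{0..2*pi}. cmod (vderiv j \<phi> t))"
  using bdd_above_vderiv[OF assms(1)] assms(2) by (intro cSUP_upper)

lemma SUP_vderiv_nonneg:
  assumes "\<phi> \<in> circle_test"
  shows "0 \<le> (SUP t\<in>{0..2*pi}. cmod (vderiv j \<phi> t))"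
  by (rule order_trans[OF norm_ge_zero norm_vderiv_le_SUP[OF assms, of 0]]) simp

lemma test_seminorm_nonneg: "\<phi> \<in> circle_test \<Longrightarrow> 0 \<le> test_seminorm N \<phi>"
  unfolding test_seminorm_def by (intro sum_nonneg SUP_vderiv_nonneg)

lemma test_seminorm_mono: "\<phi> \<in> circle_test \<Longrightarrow> N \<le> M \<Longrightarrow> test_seminorm N \<phi> \<le> test_seminorm M \<phi>"
  unfolding test_seminorm_def by (intro sum_mono2 SUP_vderiv_nonneg) auto

lemma norm_vderiv_le_seminorm:
  assumes "\<phi> \<in> circle_test" "t \<in> {0..2*pi}" "j \<le> N"
  shows "cmod (vderiv j \<phi> t) \<le> test_seminorm N \<phi>"
proof -
  have "cmod (vderiv j \<phi> t) \<le> (SUP t\<in>{0..2*pi}. cmod (vderiv j \<phi> t))"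
    by (rule norm_vderiv_le_SUP[OF assms(1,2)])
  also have "\<dots> \<le> test_seminorm N \<phi>"
    unfolding test_seminorm_def using assms
    by (intro member_le_sum[where f = "\<lambda>j. SUP t\<in>{0..2*pi}. cmod (vderiv j \<phi> t)"] SUP_vderiv_nonneg) auto
  finally show ?thesis .
qed

lemma test_seminorm_le:
  assumes "\<And>j t. j \<le> N \<Longrightarrow> t \<in> {0..2*pi} \<Longrightarrow> cmod (vderiv j \<phi> t) \<le> B"
  shows "test_seminorm N \<phi> \<le> (real N + 1) * B"
proof -
  have "test_seminorm N \<phi> \<le> (\<Sum>j\<le>N. B)"
    unfolding test_seminorm_def by (intro sum_mono cSUP_least assms) auto
  then show ?thesis by (simp add: algebra_simps)
qed

text \<open>Every \<open>twist\<close> costs a factor |a| + 1 and one order of differentiation. The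
  order \<open>j\<close> is generalised because the summand \<open>vderiv 1\<close> of the operator
  raises it by one in the induction step.\<close>

lemma norm_vderiv_twist_le:
  assumes "\<phi> \<in> circle_test" "t \<in> {0..2*pi}"
  shows "cmod (vderiv j ((twist a ^^ k) \<phi>) t) \<le> (\<bar>a\<bar> + 1) ^ k * test_seminorm (j + k) \<phi>"
  using assms(1)
proof (induction k arbitrary: j \<phi>)
  case 0
  then show ?case using norm_vderiv_le_seminorm[OF _ assms(2)] by simp
next
  case (Suc k)
  let ?\<psi> = "(twist a ^^ k) \<phi>"
  have \<psi>: "?\<psi> \<in> circle_test" by (rule twist_in_circle_test[OF Suc.prems])
  have "vderiv j ((twist a ^^ Suc k) \<phi>) t = \<i> * of_real a * vderiv j ?\<psi> t + vderiv (Suc j) ?\<psi> t"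
    using vderiv_add[OF circle_test_cmult[OF \<psi>, of "\<i> * of_real a"] vderiv_in_circle_test[OF \<psi>, of 1], of j]
      vderiv_cmult[OF \<psi>, of j "\<i> * of_real a"]
    by (simp add: twist_def vderiv_add_index)
  then have "cmod (vderiv j ((twist a ^^ Suc k) \<phi>) t) \<le>
      \<bar>a\<bar> * cmod (vderiv j ?\<psi> t) + cmod (vderiv (Suc j) ?\<psi> t)"
    using norm_triangle_ineq[of "\<i> * of_real a * vderiv j ?\<psi> t" "vderiv (Suc j) ?\<psi> t"]
    by (simp add: norm_mult)
  also have "\<dots> \<le> \<bar>a\<bar> * ((\<bar>a\<bar> + 1) ^ k * test_seminorm (j + Suc k) \<phi>)
      + (\<bar>a\<bar> + 1) ^ k * test_seminorm (j + Suc k) \<phi>"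
  proof (intro add_mono mult_left_mono)
    have "cmod (vderiv j ?\<psi> t) \<le> (\<bar>a\<bar> + 1) ^ k * test_seminorm (j + k) \<phi>"
      by (rule Suc.IH[OF Suc.prems])
    also have "\<dots> \<le> (\<bar>a\<bar> + 1) ^ k * test_seminorm (j + Suc k) \<phi>"
      by (intro mult_left_mono test_seminorm_mono Suc.prems) auto
    finally show "cmod (vderiv j ?\<psi> t) \<le> (\<bar>a\<bar> + 1) ^ k * test_seminorm (j + Suc k) \<phi>" .
    show "cmod (vderiv (Suc j) ?\<psi> t) \<le> (\<bar>a\<bar> + 1) ^ k * test_seminorm (j + Suc k) \<phi>"
      using Suc.IH[OF Suc.prems, of "Suc j"] by simp
  qed auto
  also have "\<dots> = (\<bar>a\<bar> + 1) ^ Suc k * test_seminorm (j + Suc k) \<phi>"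
    by (simp add: algebra_simps)
  finally show ?case .
qed

lemma test_seminorm_cis_mult_le:
  assumes "\<phi> \<in> circle_test"
  shows "test_seminorm N (\<lambda>t. cis (a * t) * \<phi> t)
    \<le> (real N + 1) * ((\<bar>a\<bar> + 1) ^ N * test_seminorm N \<phi>)"
proof (rule test_seminorm_le)
  fix j t assume "j \<le> N" "t \<in> {0..2*pi}"
  have "cmod (vderiv j (\<lambda>t. cis (a * t) * \<phi> t) t) = cmod ((twist a ^^ j) \<phi> t)"
    using assms by (simp add: vderiv_cis_mult norm_mult)
  also have "\<dots> \<le> (\<bar>a\<bar> + 1) ^ j * test_seminorm j \<phi>"
    using norm_vderiv_twist_le[OF assms \<open>t \<in> _\<close>, of 0 j a] by simp
  also have "\<dots> \<le> (\<bar>a\<bar> + 1) ^ N * test_seminorm N \<phi>"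
    using \<open>j \<le> N\<close> assms
    by (intro mult_mono power_increasing test_seminorm_mono test_seminorm_nonneg) auto
  finally show "cmod (vderiv j (\<lambda>t. cis (a * t) * \<phi> t) t) \<le> (\<bar>a\<bar> + 1) ^ N * test_seminorm N \<phi>" .
qed

subsection \<open>Distributions\<close>

lemma circle_distributionsI:
  assumes "\<And>\<phi> \<psi>. \<phi> \<in> circle_test \<Longrightarrow> \<psi> \<in> circle_test \<Longrightarrow> u (\<lambda>t. \<phi> t + \<psi> t) = u \<phi> + u \<psi>"
    and "\<And>\<phi> a. \<phi> \<in> circle_test \<Longrightarrow> u (\<lambda>t. a * \<phi> t) = a * u \<phi>"
    and "\<And>\<phi>. \<phi> \<in> circle_test \<Longrightarrow> cmod (u \<phi>) \<le> C * test_seminorm N \<phi>"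
  shows "u \<in> circle_distributions"
  using assms unfolding circle_distributions_def test_seminorm_def by blast

lemma circle_distributions_seminormE:
  assumes "u \<in> circle_distributions"
  obtains N C where "C \<ge> 0" "\<And>\<phi>. \<phi> \<in> circle_test \<Longrightarrow> cmod (u \<phi>) \<le> C * test_seminorm N \<phi>"
proof -
  obtain N C where C: "\<And>\<phi>. \<phi> \<in> circle_test \<Longrightarrow> cmod (u \<phi>) \<le> C * test_seminorm N \<phi>"
    using assms unfolding circle_distributions_def test_seminorm_def by blast
  \<comment> \<open>The definition admits any real constant; a nonnegative one is what inequalities
    between seminorms can be multiplied by.\<close>
  have "cmod (u \<phi>) \<le> max C 0 * test_seminorm N \<phi>" if "\<phi> \<in> circle_test" for \<phi>
    by (rule order_trans[OF C[OF that]], rule mult_right_mono)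
      (auto simp: test_seminorm_nonneg that)
  then show ?thesis using that[of "max C 0" N] by auto
qed

lemma circle_distributions_add_fun:
  "u \<in> circle_distributions \<Longrightarrow> \<phi> \<in> circle_test \<Longrightarrow> \<psi> \<in> circle_test \<Longrightarrow>
    u (\<lambda>t. \<phi> t + \<psi> t) = u \<phi> + u \<psi>"
  by (auto simp: circle_distributions_def)

lemma circle_distributions_cmult_fun:
  "u \<in> circle_distributions \<Longrightarrow> \<phi> \<in> circle_test \<Longrightarrow> u (\<lambda>t. a * \<phi> t) = a * u \<phi>"
  by (auto simp: circle_distributions_def)

lemma distr_eq_sym: "distr_eq u v \<Longrightarrow> distr_eq v u"
  by (simp add: distr_eq_def)

text \<open>The defining conditions only test arguments in \<open>circle_test\<close>, which is
  closed under sums and multiples. Boundary values are computed only up to \<open>distr_eq\<close>,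
  hence the need.\<close>

lemma circle_distributions_cong:
  assumes "u \<in> circle_distributions" "distr_eq u v"
  shows "v \<in> circle_distributions"
proof -
  obtain N C where C: "\<And>\<phi>. \<phi> \<in> circle_test \<Longrightarrow> cmod (u \<phi>) \<le> C * test_seminorm N \<phi>"
    using circle_distributions_seminormE[OF assms(1)] by metis
  show ?thesis
    using assms circle_distributions_add_fun[OF assms(1)] circle_distributions_cmult_fun[OF assms(1)] C
    by (intro circle_distributionsI[of v C N])
      (auto simp: distr_eq_def circle_test_add circle_test_cmult)
qed

lemma circle_distributions_add:
  assumes "u \<in> circle_distributions" "v \<in> circle_distributions"
  shows "(\<lambda>\<phi>. u \<phi> + v \<phi>) \<in> circle_distributions"
proof -
  obtain N C where C: "C \<ge> 0" "\<And>\<phi>. \<phi> \<in> circle_test \<Longrightarrow> cmod (u \<phi>) \<le> C * test_seminorm N \<phi>"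
    using circle_distributions_seminormE[OF assms(1)] by metis
  obtain M D where D: "D \<ge> 0" "\<And>\<phi>. \<phi> \<in> circle_test \<Longrightarrow> cmod (v \<phi>) \<le> D * test_seminorm M \<phi>"
    using circle_distributions_seminormE[OF assms(2)] by metis
  show ?thesis
  proof (rule circle_distributionsI[where C = "C + D" and N = "max N M"])
    fix \<phi> assume \<phi>: "\<phi> \<in> circle_test"
    have "cmod (u \<phi> + v \<phi>) \<le> C * test_seminorm N \<phi> + D * test_seminorm M \<phi>"
      using C(2)[OF \<phi>] D(2)[OF \<phi>] norm_triangle_ineq[of "u \<phi>" "v \<phi>"] by linarith
    also have "\<dots> \<le> C * test_seminorm (max N M) \<phi> + D * test_seminorm (max N M) \<phi>"
      using C(1) D(1) \<phi> by (intro add_mono mult_left_mono test_seminorm_mono) auto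
    finally show "cmod (u \<phi> + v \<phi>) \<le> (C + D) * test_seminorm (max N M) \<phi>"
      by (simp add: algebra_simps)
  qed (use assms in \<open>auto simp: circle_distributions_add_fun circle_distributions_cmult_fun algebra_simps\<close>)
qed

lemma circle_distributions_cmult:
  assumes "u \<in> circle_distributions"
  shows "(\<lambda>\<phi>. b * u \<phi>) \<in> circle_distributions"
proof -
  obtain N C where C: "C \<ge> 0" "\<And>\<phi>. \<phi> \<in> circle_test \<Longrightarrow> cmod (u \<phi>) \<le> C * test_seminorm N \<phi>"
    using circle_distributions_seminormE[OF assms(1)] by metis
  show ?thesis
  proof (rule circle_distributionsI[where C = "cmod b * C" and N = N])
    fix \<phi> assume \<phi>: "\<phi> \<in> circle_test"
    show "cmod (b * u \<phi>) \<le> cmod b * C * test_seminorm N \<phi>"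
      using mult_left_mono[OF C(2)[OF \<phi>], of "cmod b"] by (simp add: norm_mult mult.assoc)
  qed (use assms in \<open>auto simp: circle_distributions_add_fun circle_distributions_cmult_fun algebra_simps\<close>)
qed

lemma circle_distributions_sum:
  assumes "finite A" "\<And>x. x \<in> A \<Longrightarrow> u x \<in> circle_distributions"
  shows "(\<lambda>\<phi>. \<Sum>x\<in>A. u x \<phi>) \<in> circle_distributions"
  using assms
proof (induction A rule: finite_induct)
  case empty
  show ?case by (rule circle_distributionsI[of _ 0 0]) auto
next
  case (insert x A)
  then show ?case by (auto intro!: circle_distributions_add)
qed

lemma distr_mult_cis_in_circle_distributions:
  assumes "u \<in> circle_distributions" "a \<in> \<int>"
  shows "distr_mult (\<lambda>t. cis (a * t)) u \<in> circle_distributions"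
proof -
  obtain N C where C: "C \<ge> 0" "\<And>\<phi>. \<phi> \<in> circle_test \<Longrightarrow> cmod (u \<phi>) \<le> C * test_seminorm N \<phi>"
    using circle_distributions_seminormE[OF assms(1)] by metis
  show ?thesis
  proof (rule circle_distributionsI[where C = "C * ((real N + 1) * (\<bar>a\<bar> + 1) ^ N)" and N = N])
    fix \<phi> assume \<phi>: "\<phi> \<in> circle_test"
    have "cmod (distr_mult (\<lambda>t. cis (a * t)) u \<phi>) \<le> C * test_seminorm N (\<lambda>t. cis (a * t) * \<phi> t)"
      unfolding distr_mult_def by (rule C(2)[OF circle_test_cis_mult[OF \<phi> assms(2)]])
    also have "\<dots> \<le> C * ((real N + 1) * ((\<bar>a\<bar> + 1) ^ N * test_seminorm N \<phi>))"
      by (intro mult_left_mono C(1) test_seminorm_cis_mult_le \<phi>)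
    finally show "cmod (distr_mult (\<lambda>t. cis (a * t)) u \<phi>)
        \<le> C * ((real N + 1) * (\<bar>a\<bar> + 1) ^ N) * test_seminorm N \<phi>"
      by (simp add: mult.assoc)
  next
    fix \<phi> \<psi> assume "\<phi> \<in> circle_test" "\<psi> \<in> circle_test"
    then show "distr_mult (\<lambda>t. cis (a * t)) u (\<lambda>t. \<phi> t + \<psi> t) =
        distr_mult (\<lambda>t. cis (a * t)) u \<phi> + distr_mult (\<lambda>t. cis (a * t)) u \<psi>"
      using circle_distributions_add_fun[OF assms(1) circle_test_cis_mult[OF _ assms(2)]
          circle_test_cis_mult[OF _ assms(2)]]
      by (simp add: distr_mult_def distrib_left)
  next
    fix \<phi> b assume "\<phi> \<in> circle_test"
    then show "distr_mult (\<lambda>t. cis (a * t)) u (\<lambda>t. b * \<phi> t) = b * distr_mult (\<lambda>t. cis (a * t)) u \<phi>"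
      using circle_distributions_cmult_fun[OF assms(1) circle_test_cis_mult[OF _ assms(2)]]
      by (simp add: distr_mult_def mult.left_commute)
  qed
qed

subsection \<open>Trigonometric series\<close>

text \<open>The frequencies \<open>a m\<close> are left free so that the same lemmas serve the
  frequencies -m and m of the two halves of the Poisson kernel.\<close>

lemma uniform_limit_cis_series:
  fixes c :: "nat \<Rightarrow> complex"
  assumes "summable (\<lambda>m. cmod (c m))"
  shows "uniform_limit A (\<lambda>n t. \<Sum>m<n. c m * cis (a m * t)) (\<lambda>t. \<Sum>m. c m * cis (a m * t)) sequentially"
  by (rule Weierstrass_m_test[OF _ assms]) (simp add: norm_mult)

lemma summable_cis_series:
  fixes c :: "nat \<Rightarrow> complex"
  assumes "summable (\<lambda>m. cmod (c m))"
  shows "summable (\<lambda>m. c m * cis (a m * t))"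
  by (rule summable_norm_cancel) (use assms in \<open>simp add: norm_mult\<close>)

lemma sums_integral_cis_series:
  fixes c :: "nat \<Rightarrow> complex"
  assumes "summable (\<lambda>m. cmod (c m))" and G: "continuous_on {x..y} G"
  shows "(\<lambda>m. c m * integral {x..y} (\<lambda>t. cis (a m * t) * G t)) sums
    integral {x..y} (\<lambda>t. (\<Sum>m. c m * cis (a m * t)) * G t)"
proof -
  have "bounded (G ` {x..y})"
    by (intro compact_imp_bounded compact_continuous_image G compact_Icc)
  then obtain B where B: "\<And>t. t \<in> {x..y} \<Longrightarrow> cmod (G t) \<le> B"
    by (force simp: bounded_iff)
  let ?f = "\<lambda>m t. c m * (cis (a m * t) * G t)"
  \<comment> \<open>\<open>G\<close> is bounded on the compact interval, so the products still have
    a summable majorant.\<close>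
  have lim: "uniform_limit {x..y} (\<lambda>n t. \<Sum>m<n. ?f m t) (\<lambda>t. \<Sum>m. ?f m t) sequentially"
  proof (rule Weierstrass_m_test)
    show "cmod (?f m t) \<le> cmod (c m) * B" if "t \<in> {x..y}" for m t
      using B[OF that] by (simp add: norm_mult mult_left_mono)
    show "summable (\<lambda>m. cmod (c m) * B)"
      by (rule summable_mult2[OF assms(1)])
  qed
  have cont: "continuous_on {x..y} (?f m)" for m
    by (intro continuous_intros G)
  then have sum_cont: "continuous_on {x..y} (\<lambda>t. \<Sum>m<n. ?f m t)" for n
    by (intro continuous_on_sum) auto
  obtain I J where I: "\<And>n. ((\<lambda>t. \<Sum>m<n. ?f m t) has_integral I n) {x..y}"
    and J: "((\<lambda>t. \<Sum>m. ?f m t) has_integral J) {x..y}" and IJ: "I \<longlonglongrightarrow> J"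
    using uniform_limit_integral[OF lim sum_cont] by auto
  have I_eq: "I n = (\<Sum>m<n. c m * integral {x..y} (\<lambda>t. cis (a m * t) * G t))" for n
  proof -
    have "I n = integral {x..y} (\<lambda>t. \<Sum>m<n. ?f m t)"
      using I[of n] by (simp add: integral_unique)
    also have "\<dots> = (\<Sum>m<n. integral {x..y} (?f m))"
      by (intro integral_sum integrable_continuous_real cont) auto
    finally show ?thesis by simp
  qed
  have "(\<Sum>m. ?f m t) = (\<Sum>m. c m * cis (a m * t)) * G t" for t
    using suminf_mult2[OF summable_cis_series[OF assms(1), of a t], of "G t"] by (simp add: mult.assoc)
  with integral_unique[OF J] have "J = integral {x..y} (\<lambda>t. (\<Sum>m. c m * cis (a m * t)) * G t)"
    by simp
  then show ?thesis
    using IJ unfolding sums_def I_eq[abs_def] by simp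
qed

lemma integral_cis:
  assumes "a \<in> \<int>"
  shows "integral {0..2*pi} (\<lambda>t. cis (a * t)) = (if a = 0 then 2 * pi else 0)"
proof (cases "a = 0")
  case False
  have "((\<lambda>t. cis (a * t)) has_integral
      cis (a * (2 * pi)) / (\<i> * of_real a) - cis (a * 0) / (\<i> * of_real a)) {0..2*pi}"
  proof (intro fundamental_theorem_of_calculus)
    show "((\<lambda>t. cis (a * t) / (\<i> * of_real a)) has_vector_derivative cis (a * t)) (at t within {0..2*pi})" for t
      using has_vector_derivative_divide[OF has_vector_derivative_cis_mult[of a t "{0..2*pi}"], of "\<i> * of_real a"]
        False by simp
  qed simp
  then have "((\<lambda>t. cis (a * t)) has_integral 0) {0..2*pi}"
    using cis_periodic[OF assms, of 0] by simp
  then show ?thesis using False by (simp add: integral_unique)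
qed (simp add: scaleR_conv_of_real)

text \<open>The differentiated series has the majorant |a_m c_m| on the whole line, hence converges
  uniformly; with convergence at the single point 0 this permits termwise differentiation.\<close>

lemma has_vector_derivative_cis_series:
  fixes c :: "nat \<Rightarrow> complex"
  assumes c: "summable (\<lambda>m. cmod (c m))"
    and ac: "summable (\<lambda>m. \<bar>a m\<bar> * cmod (c m))"
  shows "((\<lambda>t. \<Sum>m. c m * cis (a m * t)) has_vector_derivative
    (\<Sum>m. (c m * (\<i> * of_real (a m))) * cis (a m * t))) (at t)"
proof -
  let ?f = "\<lambda>m t. c m * cis (a m * t)"
  let ?d = "\<lambda>m t. (c m * (\<i> * of_real (a m))) * cis (a m * t)"
  have lim: "uniform_limit UNIV (\<lambda>n t. \<Sum>m<n. ?d m t) (\<lambda>t. \<Sum>m. ?d m t) sequentially"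
    by (rule uniform_limit_cis_series) (use ac in \<open>simp add: norm_mult mult.commute\<close>)
  have "\<exists>g. \<forall>t\<in>UNIV. (\<lambda>m. ?f m t) sums g t \<and>
      (g has_derivative (\<lambda>h. h *\<^sub>R (\<Sum>m. ?d m t))) (at t within UNIV)"
  proof (rule has_derivative_series[where f' = "\<lambda>m t h. h *\<^sub>R ?d m t" and x = 0])
    show "(?f m has_derivative (\<lambda>h. h *\<^sub>R ?d m t)) (at t within UNIV)" for m t
      using has_vector_derivative_mult_right[OF has_vector_derivative_cis_mult[of "a m" t UNIV], of "c m"]
      by (simp add: has_vector_derivative_def mult.assoc)
    show "\<forall>\<^sub>F n in sequentially. \<forall>t\<in>UNIV. \<forall>h.
        cmod ((\<Sum>m<n. h *\<^sub>R ?d m t) - h *\<^sub>R (\<Sum>m. ?d m t)) \<le> e * norm h" if "e > 0" for e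
      using uniform_limitD[OF lim that]
    proof eventually_elim
      case (elim n)
      show ?case
      proof (intro ballI allI)
        fix t h :: real
        have "cmod ((\<Sum>m<n. h *\<^sub>R ?d m t) - h *\<^sub>R (\<Sum>m. ?d m t))
            = \<bar>h\<bar> * dist (\<Sum>m<n. ?d m t) (\<Sum>m. ?d m t)"
          unfolding scaleR_right.sum[symmetric] scaleR_diff_right[symmetric] by (simp add: dist_norm)
        also have "\<dots> \<le> \<bar>h\<bar> * e"
          using elim by (intro mult_left_mono) (auto intro: less_imp_le)
        finally show "cmod ((\<Sum>m<n. h *\<^sub>R ?d m t) - h *\<^sub>R (\<Sum>m. ?d m t)) \<le> e * norm h"
          by (simp add: mult.commute)
      qed
    qed
    show "(\<lambda>m. ?f m 0) sums (\<Sum>m. ?f m 0)"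
      by (rule summable_sums[OF summable_cis_series[OF c]])
  qed auto
  then obtain g where g: "\<And>t. (\<lambda>m. ?f m t) sums g t"
    "\<And>t. (g has_derivative (\<lambda>h. h *\<^sub>R (\<Sum>m. ?d m t))) (at t)" by auto
  have "g = (\<lambda>t. \<Sum>m. ?f m t)" using g(1) by (simp add: fun_eq_iff sums_iff)
  then show ?thesis using g(2)[of t] by (simp add: has_vector_derivative_def)
qed

text \<open>Each derivative multiplies the coefficients by i a_m, of modulus at most m, and decay
  faster than every power absorbs this.\<close>

lemma cis_series_in_circle_test:
  fixes b :: "nat \<Rightarrow> complex"
  assumes b: "\<And>k. summable (\<lambda>m. real m ^ k * cmod (b m))"
    and a: "\<And>m. a m \<in> \<int>" "\<And>m. \<bar>a m\<bar> \<le> real m"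
  shows "(\<lambda>t. \<Sum>m. b m * cis (a m * t)) \<in> circle_test"
proof (rule circle_testI[where G = "\<lambda>k t. \<Sum>m. (b m * (\<i> * of_real (a m)) ^ k) * cis (a m * t)"])
  have summable: "summable (\<lambda>m. \<bar>a m\<bar> ^ k * cmod (b m))" for k
    by (rule summable_comparison_test_ev[OF _ b[of k]])
      (intro always_eventually allI, use a(2) in \<open>simp add: mult_right_mono power_mono\<close>)
  fix k t
  have "summable (\<lambda>m. cmod (b m * (\<i> * of_real (a m)) ^ k))"
    using summable[of k] by (simp add: norm_mult norm_power mult.commute)
  moreover have "summable (\<lambda>m. \<bar>a m\<bar> * cmod (b m * (\<i> * of_real (a m)) ^ k))"
    using summable[of "Suc k"] by (simp add: norm_mult norm_power mult_ac)
  ultimately have "((\<lambda>t. \<Sum>m. (b m * (\<i> * of_real (a m)) ^ k) * cis (a m * t)) has_vector_derivative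
      (\<Sum>m. ((b m * (\<i> * of_real (a m)) ^ k) * (\<i> * of_real (a m))) * cis (a m * t))) (at t)"
    by (rule has_vector_derivative_cis_series)
  then show "((\<lambda>t. \<Sum>m. (b m * (\<i> * of_real (a m)) ^ k) * cis (a m * t)) has_vector_derivative
      (\<Sum>m. (b m * (\<i> * of_real (a m)) ^ Suc k) * cis (a m * t))) (at t)"
    by (simp only: power_Suc2 mult.assoc)
qed (simp_all add: cis_periodic a)

subsection \<open>Fourier coefficients and pairings with holomorphic functions\<close>

text \<open>Up to the factor \<open>2 \<pi>\<close> this is the Fourier coefficient of index \<open>- m\<close>; a pairing with a
  holomorphic function involves only these.\<close>

definition fourier :: "(real \<Rightarrow> complex) \<Rightarrow> nat \<Rightarrow> complex" where
  "fourier \<phi> m = integral {0..2*pi} (\<lambda>t. cis (real m * t) * \<phi> t)"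

definition taylor_coeff :: "(complex \<Rightarrow> complex) \<Rightarrow> nat \<Rightarrow> complex" where
  "taylor_coeff h m = (deriv ^^ m) h 0 / fact m"

text \<open>Orthogonality of the characters: in termwise integration only a frequency a_k = -m
  survives.\<close>

lemma fourier_cis_series:
  fixes c :: "nat \<Rightarrow> complex"
  assumes "summable (\<lambda>m. cmod (c m))" "\<And>m. a m \<in> \<int>"
  shows "(\<lambda>k. c k * (if a k + real m = 0 then 2 * pi else 0)) sums fourier (\<lambda>t. \<Sum>k. c k * cis (a k * t)) m"
proof -
  have "integral {0..2*pi} (\<lambda>t. cis (a k * t) * cis (real m * t)) = (if a k + real m = 0 then 2 * pi else 0)" for k
    using integral_cis[of "a k + real m"] assms(2)[of k] by (simp add: cis_mult distrib_right)
  moreover have "continuous_on {0..2*pi} (\<lambda>t. cis (real m * t))"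
    by (intro continuous_intros)
  ultimately show ?thesis
    using sums_integral_cis_series[OF assms(1), of 0 "2*pi" "\<lambda>t. cis (real m * t)" a]
    by (simp add: fourier_def mult.commute)
qed

lemma fourier_cis_series_neg:
  fixes c :: "nat \<Rightarrow> complex"
  assumes "summable (\<lambda>m. cmod (c m))"
  shows "fourier (\<lambda>t. \<Sum>k. c k * cis (- real k * t)) m = 2 * pi * c m"
proof -
  have "(\<lambda>k. c k * (if - real k + real m = 0 then 2 * pi else 0)) = (\<lambda>k. if k = m then c k * (2 * pi) else 0)"
    by (auto simp: fun_eq_iff)
  with fourier_cis_series[OF assms, of "\<lambda>k. - real k" m]
  have "(\<lambda>k. if k = m then c k * (2 * pi) else 0) sums fourier (\<lambda>t. \<Sum>k. c k * cis (- real k * t)) m"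
    by simp
  from sums_unique2[OF this sums_single[of m "\<lambda>k. c k * (2 * pi)"]] show ?thesis
    by (simp add: mult.commute)
qed

text \<open>Frequencies k, m >= 0 add up to 0 only at k = m = 0, and \<open>c 0 = 0\<close> removes
  this case.\<close>

lemma fourier_cis_series_pos:
  fixes c :: "nat \<Rightarrow> complex"
  assumes "summable (\<lambda>m. cmod (c m))" "c 0 = 0"
  shows "fourier (\<lambda>t. \<Sum>k. c k * cis (real k * t)) m = 0"
proof -
  have "(\<lambda>k. c k * (if real k + real m = 0 then 2 * pi else 0)) = (\<lambda>k. 0)"
    using assms(2) by (auto simp: fun_eq_iff simp flip: of_nat_add)
  with fourier_cis_series[OF assms(1), of "\<lambda>k. real k" m] show ?thesis
    by (simp add: sums_iff)
qed

section \<open>Decay of the Fourier coefficients of a test function\<close>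

lemma continuous_on_cis_mult_test:
  assumes "\<phi> \<in> circle_test"
  shows "continuous_on A (\<lambda>t. cis (a * t) * \<phi> t)"
proof (rule continuous_on_mult)
  show "continuous_on A (\<lambda>t. cis (a * t))"
    by (intro continuous_intros)
qed (rule continuous_on_circle_test[OF assms])

lemma fourier_add:
  assumes "\<phi> \<in> circle_test" "\<psi> \<in> circle_test"
  shows "fourier (\<lambda>t. \<phi> t + \<psi> t) m = fourier \<phi> m + fourier \<psi> m"
  unfolding fourier_def distrib_left
  by (intro integral_add integrable_continuous_real continuous_on_cis_mult_test assms)

text \<open>Integration by parts, in the form that the derivative of
  \<open>cis (m t) * \<phi> t\<close> integrates to 0 over a period; this derivative is
  \<open>cis (m t)\<close> times the twist of \<open>\<phi>\<close>.\<close>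

lemma fourier_vderiv:
  assumes "\<phi> \<in> circle_test"
  shows "fourier (vderiv 1 \<phi>) m = - (\<i> * of_nat m) * fourier \<phi> m"
proof -
  have "((\<lambda>t. cis (real m * t) * twist (real m) \<phi> t) has_integral
      cis (real m * (2 * pi)) * \<phi> (2 * pi) - cis (real m * 0) * \<phi> 0) {0..2*pi}"
    by (rule fundamental_theorem_of_calculus)
      (auto intro: has_vector_derivative_at_within[OF has_vector_derivative_cis_mult_test[OF assms]])
  moreover have "cis (real m * (2 * pi)) * \<phi> (2 * pi) = \<phi> 0"
    using cis_periodic[of "real m" 0] circle_test_periodic[OF assms, of 0] by simp
  ultimately have zero: "integral {0..2*pi} (\<lambda>t. cis (real m * t) * twist (real m) \<phi> t) = 0"
    by (simp add: integral_unique)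
  have "integral {0..2*pi} (\<lambda>t. cis (real m * t) * twist (real m) \<phi> t) =
      integral {0..2*pi} (\<lambda>t. \<i> * of_nat m * (cis (real m * t) * \<phi> t) + cis (real m * t) * vderiv 1 \<phi> t)"
    by (simp add: twist_def algebra_simps)
  also have "\<dots> = integral {0..2*pi} (\<lambda>t. \<i> * of_nat m * (cis (real m * t) * \<phi> t)) + fourier (vderiv 1 \<phi>) m"
    unfolding fourier_def
    by (intro integral_add integrable_continuous_real continuous_on_mult_left
        continuous_on_cis_mult_test vderiv_in_circle_test assms)
  also have "integral {0..2*pi} (\<lambda>t. \<i> * of_nat m * (cis (real m * t) * \<phi> t)) = \<i> * of_nat m * fourier \<phi> m"
    unfolding fourier_def by (rule integral_mult_right)
  finally show ?thesis unfolding zero by (simp add: eq_neg_iff_add_eq_0 add.commute)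
qed

lemma norm_fourier_le:
  assumes "\<phi> \<in> circle_test"
  shows "real m ^ N * cmod (fourier \<phi> m) \<le> 2 * pi * test_seminorm N \<phi>"
proof -
  have "fourier (vderiv N \<phi>) m = (- (\<i> * of_nat m)) ^ N * fourier \<phi> m"
  proof (induction N)
    case (Suc N)
    have "fourier (vderiv (Suc N) \<phi>) m = fourier (vderiv 1 (vderiv N \<phi>)) m"
      by (simp add: vderiv_add_index)
    also have "\<dots> = - (\<i> * of_nat m) * fourier (vderiv N \<phi>) m"
      by (rule fourier_vderiv[OF vderiv_in_circle_test[OF assms]])
    finally show ?case using Suc by simp
  qed simp
  then have "real m ^ N * cmod (fourier \<phi> m) = cmod (fourier (vderiv N \<phi>) m)"
    by (simp add: norm_mult norm_power)
  also have "\<dots> \<le> test_seminorm N \<phi> * (2 * pi - 0)"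
    unfolding fourier_def
    using norm_vderiv_le_seminorm[OF assms, of _ N N]
    by (intro integral_bound continuous_on_cis_mult_test vderiv_in_circle_test assms) (auto simp: norm_mult)
  finally show ?thesis by (simp add: mult.commute)
qed

section \<open>Taylor series and pairings on circles of radius less than 1\<close>

lemma taylor_sums:
  assumes "h holomorphic_on ball 0 1" "cmod z < 1"
  shows "(\<lambda>m. taylor_coeff h m * z ^ m) sums h z"
  using holomorphic_power_series[OF assms(1), of z] assms(2) by (simp add: taylor_coeff_def)

lemma summable_taylor:
  assumes "h holomorphic_on ball 0 1" "cmod z < 1"
  shows "summable (\<lambda>m. cmod (taylor_coeff h m * z ^ m))"
proof -
  obtain r where r: "cmod z < r" "r < 1" using dense[OF assms(2)] by auto
  have "0 < r" using r norm_ge_zero[of z] by linarith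
  show ?thesis
    by (rule powser_insidea[OF sums_summable[OF taylor_sums[OF assms(1), of "of_real r"]]])
      (use r \<open>0 < r\<close> in auto)
qed

lemma circle_pairing_sums:
  assumes h: "h holomorphic_on ball 0 1" and \<phi>: "continuous_on {0..2*pi} \<phi>" and r: "0 \<le> r" "r < 1"
  shows "(\<lambda>m. taylor_coeff h m * of_real r ^ m * fourier \<phi> m) sums circle_pairing h \<phi> r"
proof -
  have "(\<Sum>m. taylor_coeff h m * of_real r ^ m * cis (real m * t)) = h (of_real r * exp (\<i> * of_real t))" for t
  proof -
    have "(\<lambda>m. taylor_coeff h m * (of_real r * cis t) ^ m) sums h (of_real r * cis t)"
      by (rule taylor_sums[OF h]) (use r in \<open>simp add: norm_mult\<close>)
    then show ?thesis
      by (simp add: sums_iff power_mult_distrib Complex.DeMoivre mult.assoc flip: cis_conv_exp)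
  qed
  then show ?thesis
    using sums_integral_cis_series[OF summable_taylor[OF h, of "of_real r"] \<phi>, of "\<lambda>m. real m"] r
    by (simp add: circle_pairing_def fourier_def)
qed

subsection \<open>Growth of the Taylor coefficients\<close>

lemma eventually_at_left_1_pos: "eventually (\<lambda>r::real. 0 < r \<and> r < 1) (at_left 1)"
  by (auto simp: eventually_at_left_field intro!: exI[of _ 0])

lemma has_boundary_value_tendsto:
  assumes "has_boundary_value g" "\<phi> \<in> circle_test"
  shows "(circle_pairing g \<phi> \<longlongrightarrow> boundary_value g \<phi>) (at_left 1)"
proof -
  obtain L where L: "(circle_pairing g \<phi> \<longlongrightarrow> L) (at_left 1)"
    using assms by (auto simp: has_boundary_value_def)
  then show ?thesis
    unfolding boundary_value_def using tendsto_Lim[OF trivial_limit_at_left_real L] by simp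
qed

lemma summable_inverse_Suc_square: "summable (\<lambda>m. 1 / (real m + 1) ^ 2)"
  using inverse_power_summable[of 2, where 'a = real] summable_Suc_iff[of "\<lambda>n. inverse (real n ^ 2)"]
  by (simp add: inverse_eq_divide add.commute)

text \<open>Gliding hump: if the coefficients \<open>a\<^sub>m\<close> outgrow every power of \<open>m\<close>, then the function with
  Fourier coefficients \<open>1 / a\<^sub>m\<close> along a sufficiently sparse set of \<open>m\<close> is smooth, and its pairing with
  \<open>h\<close> on the circle of radius \<open>r\<close> is \<open>2 \<pi> \<Sum> r\<^sup>m\<close> over this set, which is unbounded as \<open>r\<close> tends to 1.\<close>

lemma H_b_taylor_growth:
  assumes "h \<in> H_b"
  obtains N C where "C \<ge> 0" "\<And>m. cmod (taylor_coeff h m) \<le> C * (real m + 1) ^ N"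
proof -
  have h: "h holomorphic_on ball 0 1" "has_boundary_value h"
    using assms by (auto simp: H_b_def)
  define a where "a = taylor_coeff h"
  have "\<exists>N C. \<forall>m. cmod (a m) \<le> C * (real m + 1) ^ N"
  proof (rule ccontr)
    assume "\<not> ?thesis"
    then have large: "\<exists>m. cmod (a m) > C * (real m + 1) ^ N" for N C
      by (auto simp: not_le)
    have step: "\<exists>m>M. cmod (a m) > (real m + 1) ^ N" for M N
    proof -
      \<comment> \<open>\<open>C\<close> dominates every coefficient up to index \<open>M\<close>,
        so an index whose coefficient beats \<open>C\<close> must exceed \<open>M\<close>; the
        summand 1 lets the factor \<open>C\<close> be dropped afterwards.\<close>
      define C where "C = 1 + (\<Sum>i\<le>M. cmod (a i))"
      have C: "C \<ge> 1" unfolding C_def by (simp add: sum_nonneg)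
      obtain m where m: "cmod (a m) > C * (real m + 1) ^ N" using large by blast
      have 1: "1 \<le> (real m + 1) ^ N" by (rule one_le_power) simp
      have "m > M"
      proof (rule ccontr)
        assume "\<not> m > M"
        then have "cmod (a m) \<le> (\<Sum>i\<le>M. cmod (a i))"
          by (intro member_le_sum) auto
        then have "cmod (a m) \<le> C * 1" unfolding C_def by simp
        also have "\<dots> \<le> C * (real m + 1) ^ N" using C 1 by (intro mult_left_mono) auto
        finally show False using m by simp
      qed
      moreover have "(real m + 1) ^ N \<le> C * (real m + 1) ^ N"
        using mult_right_mono[OF C, of "(real m + 1) ^ N"] by simp
      with m have "cmod (a m) > (real m + 1) ^ N" by linarith
      ultimately show ?thesis by blast
    qed
    \<comment> \<open>The exponent is tied to the position in the sequence, so that 1 / a decays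
      along it faster than every fixed power.\<close>
    have "\<exists>s. \<forall>n. (real (s n) + 1) ^ n < cmod (a (s n)) \<and> s n < s (Suc n)"
      by (rule dependent_nat_choice) (use step in blast)+
    then obtain s where s: "\<And>n. (real (s n) + 1) ^ n < cmod (a (s n))" "\<And>n. s n < s (Suc n)"
      by auto
    have mono: "strict_mono s" using s(2) by (rule strict_monoI_Suc)
    have nz: "a (s n) \<noteq> 0" for n
    proof -
      have "0 < cmod (a (s n))" by (rule le_less_trans[OF _ s(1)]) simp
      then show ?thesis by auto
    qed
    define b where "b m = (if m \<in> range s then 1 / a m else 0)" for m
    have b_summable: "summable (\<lambda>m. real m ^ k * cmod (b m))" for k
    proof (rule summable_comparison_test_ev[OF _ summable_inverse_Suc_square])
      show "\<forall>\<^sub>F m in sequentially. norm (real m ^ k * cmod (b m)) \<le> 1 / (real m + 1) ^ 2"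
        \<comment> \<open>From \<open>s (k + 2)\<close> on, indices in the range of \<open>s\<close>
          have position at least k + 2; the two spare powers leave the majorant 1 / (m +
          1)^2.\<close>
        using eventually_ge_at_top[of "s (k + 2)"]
      proof eventually_elim
        case (elim m)
        show ?case
        proof (cases "m \<in> range s")
          case True
          then obtain j where j: "m = s j" by auto
          have "k + 2 \<le> j" using elim mono j by (simp add: strict_mono_less_eq)
          then have "(real m + 1) ^ (k + 2) \<le> (real m + 1) ^ j" by (intro power_increasing) auto
          also have "\<dots> \<le> cmod (a m)" using s(1)[of j] j by simp
          finally have "(real m + 1) ^ k * (real m + 1) ^ 2 \<le> cmod (a m)" by (simp only: power_add)
          moreover have "real m ^ k * (real m + 1) ^ 2 \<le> (real m + 1) ^ k * (real m + 1) ^ 2"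
            by (intro mult_right_mono power_mono) auto
          ultimately have "real m ^ k * (real m + 1) ^ 2 \<le> cmod (a m)" by linarith
          moreover have "cmod (a m) > 0" using nz[of j] j by simp
          moreover have "(real m + 1) ^ 2 > 0" by simp
          ultimately have "real m ^ k / cmod (a m) \<le> 1 / (real m + 1) ^ 2"
            by (simp add: divide_simps mult.commute)
          then show ?thesis using True by (simp add: b_def norm_divide)
        qed (simp add: b_def)
      qed
    qed
    define \<phi> where "\<phi> = (\<lambda>t. \<Sum>m. b m * cis (- real m * t))"
    have \<phi>: "\<phi> \<in> circle_test"
      unfolding \<phi>_def by (rule cis_series_in_circle_test[OF b_summable]) auto
    have coeff: "fourier \<phi> m = 2 * pi * b m" for m
      unfolding \<phi>_def using b_summable[of 0] by (intro fourier_cis_series_neg) simp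
    define L where "L = boundary_value h \<phi>"
    have L: "(circle_pairing h \<phi> \<longlongrightarrow> L) (at_left 1)"
      unfolding L_def by (rule has_boundary_value_tendsto[OF h(2) \<phi>])
    have bound: "2 * pi * real J \<le> Re L" for J
    proof (rule tendsto_le[OF trivial_limit_at_left_real])
      show "((\<lambda>r. Re (circle_pairing h \<phi> r)) \<longlongrightarrow> Re L) (at_left 1)"
        by (rule tendsto_Re[OF L])
      \<comment> \<open>Each of the \<open>J\<close> powers tends to 1; as \<open>J\<close> is
        arbitrary, the limit \<open>L\<close> cannot be finite.\<close>
      have "((\<lambda>r. 2 * pi * (\<Sum>j<J. r ^ s j)) \<longlongrightarrow> 2 * pi * (\<Sum>j<J. 1 ^ s j)) (at_left 1)"
        by (intro tendsto_intros)
      then show "((\<lambda>r. 2 * pi * (\<Sum>j<J. r ^ s j)) \<longlongrightarrow> 2 * pi * real J) (at_left 1)"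
        by simp
      show "\<forall>\<^sub>F r in at_left 1. 2 * pi * (\<Sum>j<J. r ^ s j) \<le> Re (circle_pairing h \<phi> r)"
        using eventually_at_left_1_pos
      proof eventually_elim
        case (elim r)
        define p where "p m = (if m \<in> range s then 2 * pi * r ^ m else 0)" for m
        have "(\<lambda>m. a m * of_real r ^ m * fourier \<phi> m) sums circle_pairing h \<phi> r"
          unfolding a_def using elim by (intro circle_pairing_sums h continuous_on_circle_test \<phi>) auto
        \<comment> \<open>The coefficient 1 / a_m cancels a_m, so all terms are real and nonnegative
          and a finite subsum bounds the pairing from below.\<close>
        moreover have "a m * of_real r ^ m * fourier \<phi> m = of_real (p m)" for m
          using nz by (auto simp: coeff b_def p_def)
        ultimately have "(\<lambda>m. complex_of_real (p m)) sums circle_pairing h \<phi> r" by simp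
        then have p: "p sums Re (circle_pairing h \<phi> r)"
          using sums_Re by fastforce
        have "2 * pi * (\<Sum>j<J. r ^ s j) = (\<Sum>j<J. p (s j))"
          by (simp add: p_def sum_distrib_left)
        also have "\<dots> = sum p (s ` {..<J})"
          using mono by (subst sum.reindex) (auto intro: strict_mono_imp_inj_on inj_on_subset)
        also have "\<dots> \<le> Re (circle_pairing h \<phi> r)"
          unfolding sums_unique[OF p]
          by (rule sum_le_suminf[OF sums_summable[OF p]]) (use elim in \<open>auto simp: p_def\<close>)
        finally show ?case .
      qed
    qed
    obtain J :: nat where "Re L < real J" using reals_Archimedean2 by blast
    also have "real J \<le> 2 * pi * real J"
      using pi_ge_two mult_right_mono[of 1 "2 * pi" "real J"] by simp
    finally show False using bound[of J] by simp
  qed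
  then obtain N C where NC: "\<And>m. cmod (a m) \<le> C * (real m + 1) ^ N" by blast
  moreover have "0 \<le> C"
    using order_trans[OF norm_ge_zero NC[of 0]] by simp
  ultimately show ?thesis using that[of C N] by (auto simp: a_def)
qed

text \<open>Uniformity in the radius is the point: such a bound survives the limit r -> 1.\<close>

lemma circle_pairing_bound:
  assumes "h \<in> H_b"
  obtains K N where "\<And>\<phi> r. \<phi> \<in> circle_test \<Longrightarrow> 0 \<le> r \<Longrightarrow> r < 1 \<Longrightarrow>
    cmod (circle_pairing h \<phi> r) \<le> K * test_seminorm N \<phi>"
proof -
  obtain N C where C: "C \<ge> 0" "\<And>m. cmod (taylor_coeff h m) \<le> C * (real m + 1) ^ N"
    using H_b_taylor_growth[OF assms] by metis
  \<comment> \<open>\<open>N\<close> powers compensate the growth of the Taylor coefficients and two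
    more make the series converge. In \<open>D\<close>, the factor 2^M comes from m + 1 <= 2 m for m
    >= 1, and 2 pi from the decay estimate.\<close>
  define M where "M = N + 2"
  define D where "D = C * (2 ^ M * (2 * pi))"
  have main: "cmod (circle_pairing h \<phi> r) \<le> D * (\<Sum>m. 1 / (real m + 1) ^ 2) * test_seminorm M \<phi>"
    if \<phi>: "\<phi> \<in> circle_test" and r: "0 \<le> r" "r < 1" for \<phi> r
  proof -
    have F: "(real m + 1) ^ M * cmod (fourier \<phi> m) \<le> 2 ^ M * (2 * pi) * test_seminorm M \<phi>" for m
    \<comment> \<open>At m = 0 the decay estimate of order \<open>M\<close> has left-hand side 0 and
      says nothing, so the one of order 0 is used.\<close>
    proof (cases "m = 0")
      case True
      have "cmod (fourier \<phi> 0) \<le> 2 * pi * test_seminorm 0 \<phi>"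
        using norm_fourier_le[OF \<phi>, of 0 0] by simp
      also have "\<dots> \<le> 2 * pi * test_seminorm M \<phi>"
        by (intro mult_left_mono test_seminorm_mono \<phi>) auto
      also have "\<dots> \<le> 2 ^ M * (2 * pi * test_seminorm M \<phi>)"
        using mult_right_mono[of 1 "2 ^ M" "2 * pi * test_seminorm M \<phi>"] test_seminorm_nonneg[OF \<phi>, of M]
        by simp
      finally show ?thesis using True by (simp add: mult.assoc)
    next
      case False
      have "(real m + 1) ^ M \<le> (2 * real m) ^ M"
        using False by (intro power_mono) auto
      then have "(real m + 1) ^ M * cmod (fourier \<phi> m) \<le> 2 ^ M * (real m ^ M * cmod (fourier \<phi> m))"
        by (simp add: mult_right_mono power_mult_distrib flip: mult.assoc)
      also have "\<dots> \<le> 2 ^ M * (2 * pi * test_seminorm M \<phi>)"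
        by (intro mult_left_mono norm_fourier_le \<phi>) auto
      finally show ?thesis by (simp add: mult.assoc)
    qed
    have term_le: "cmod (taylor_coeff h m * of_real r ^ m * fourier \<phi> m)
        \<le> D * test_seminorm M \<phi> * (1 / (real m + 1) ^ 2)" for m
    proof -
      have "cmod (taylor_coeff h m * of_real r ^ m * fourier \<phi> m)
          = cmod (taylor_coeff h m) * r ^ m * cmod (fourier \<phi> m)"
        using r by (simp add: norm_mult norm_power)
      also have "\<dots> \<le> (C * (real m + 1) ^ N) * 1 * cmod (fourier \<phi> m)"
        using r C by (intro mult_right_mono mult_mono power_le_one) auto
      also have "\<dots> = C * ((real m + 1) ^ M * cmod (fourier \<phi> m)) * (1 / (real m + 1) ^ 2)"
      proof -
        have "(real m + 1) ^ M = (real m + 1) ^ N * (real m + 1) ^ 2"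
          unfolding M_def by (rule power_add)
        moreover have "(real m + 1) ^ 2 \<noteq> 0" by simp
        ultimately show ?thesis by (simp only:) (simp add: field_simps)
      qed
      also have "\<dots> \<le> C * (2 ^ M * (2 * pi) * test_seminorm M \<phi>) * (1 / (real m + 1) ^ 2)"
        using C(1) by (intro mult_right_mono mult_left_mono F) auto
      finally show ?thesis by (simp add: D_def mult.assoc)
    qed
    have sums: "(\<lambda>m. taylor_coeff h m * of_real r ^ m * fourier \<phi> m) sums circle_pairing h \<phi> r"
      using assms r by (intro circle_pairing_sums continuous_on_circle_test \<phi>) (auto simp: H_b_def)
    have "cmod (\<Sum>m. taylor_coeff h m * of_real r ^ m * fourier \<phi> m)
        \<le> (\<Sum>m. D * test_seminorm M \<phi> * (1 / (real m + 1) ^ 2))"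
      by (intro norm_suminf_le term_le summable_mult summable_inverse_Suc_square)
    then show ?thesis
      using sums_unique[OF sums] suminf_mult[OF summable_inverse_Suc_square, of "D * test_seminorm M \<phi>"]
      by (simp add: mult_ac)
  qed
  show ?thesis using that[OF main] .
qed

subsection \<open>Boundary values\<close>

text \<open>The limit is carried as an explicit functional instead of \<open>Lim\<close>, together
  with integrability, so that sums, multiples and products with powers of conj z can be treated
  termwise.\<close>

definition has_bv :: "(complex \<Rightarrow> complex) \<Rightarrow> functional \<Rightarrow> bool" where
  "has_bv g u \<longleftrightarrow> (\<forall>\<phi>\<in>circle_test.
     (\<forall>\<^sub>F r in at_left 1.
        (\<lambda>\<theta>. g (of_real r * exp (\<i> * of_real \<theta>)) * \<phi> \<theta>) absolutely_integrable_on {0..2*pi}) \<and>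
     (circle_pairing g \<phi> \<longlongrightarrow> u \<phi>) (at_left 1))"

lemma has_bv_boundary_value: "has_boundary_value g \<Longrightarrow> has_bv g (boundary_value g)"
  using has_boundary_value_tendsto[of g] by (auto simp: has_bv_def has_boundary_value_def)

lemma has_bvD:
  assumes "has_bv g u"
  shows "has_boundary_value g" "distr_eq (boundary_value g) u"
proof -
  show "has_boundary_value g" using assms by (auto simp: has_bv_def has_boundary_value_def)
  have "boundary_value g \<phi> = u \<phi>" if "\<phi> \<in> circle_test" for \<phi>
    using assms that tendsto_Lim[OF trivial_limit_at_left_real, of "circle_pairing g \<phi>"]
    by (auto simp: has_bv_def boundary_value_def)
  then show "distr_eq (boundary_value g) u" by (simp add: distr_eq_def)
qed

text \<open>Only radii in (0, 1) matter for the limit. Needed because the closed formula for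
  \<open>schwarz_fun\<close> and the identities for iterated \<open>dbar\<close> are available on
  the disk only.\<close>

lemma has_bv_cong:
  assumes "has_bv f u" "\<And>z. z \<in> ball 0 1 \<Longrightarrow> f z = g z"
  shows "has_bv g u"
  unfolding has_bv_def
proof (intro ballI conjI)
  fix \<phi> :: "real \<Rightarrow> complex" assume \<phi>: "\<phi> \<in> circle_test"
  have eq: "f (of_real r * exp (\<i> * of_real \<theta>)) = g (of_real r * exp (\<i> * of_real \<theta>))"
    if "0 < r \<and> r < 1" for r \<theta>
    using that by (intro assms(2)) (simp add: norm_mult)
  have "\<forall>\<^sub>F r in at_left 1.
      (\<lambda>\<theta>. f (of_real r * exp (\<i> * of_real \<theta>)) * \<phi> \<theta>) absolutely_integrable_on {0..2*pi}"
    using assms(1) \<phi> by (simp add: has_bv_def)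
  with eventually_at_left_1_pos
  show "\<forall>\<^sub>F r in at_left 1.
      (\<lambda>\<theta>. g (of_real r * exp (\<i> * of_real \<theta>)) * \<phi> \<theta>) absolutely_integrable_on {0..2*pi}"
    by eventually_elim (simp add: eq)
  have "\<forall>\<^sub>F r in at_left 1. circle_pairing f \<phi> r = circle_pairing g \<phi> r"
    using eventually_at_left_1_pos by eventually_elim (simp add: circle_pairing_def eq)
  then show "(circle_pairing g \<phi> \<longlongrightarrow> u \<phi>) (at_left 1)"
    using assms(1) \<phi> by (auto simp: has_bv_def intro: Lim_transform_eventually)
qed

lemma has_bv_add:
  assumes "has_bv f u" "has_bv g v"
  shows "has_bv (\<lambda>z. f z + g z) (\<lambda>\<phi>. u \<phi> + v \<phi>)"
  unfolding has_bv_def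
proof (intro ballI conjI)
  fix \<phi> :: "real \<Rightarrow> complex" assume \<phi>: "\<phi> \<in> circle_test"
  have "\<forall>\<^sub>F r in at_left 1.
      (\<lambda>\<theta>. f (of_real r * exp (\<i> * of_real \<theta>)) * \<phi> \<theta>) absolutely_integrable_on {0..2*pi} \<and>
      (\<lambda>\<theta>. g (of_real r * exp (\<i> * of_real \<theta>)) * \<phi> \<theta>) absolutely_integrable_on {0..2*pi}"
    using assms \<phi> by (simp add: has_bv_def eventually_conj)
  then have ev: "\<forall>\<^sub>F r in at_left 1.
      (\<lambda>\<theta>. (f (of_real r * exp (\<i> * of_real \<theta>)) + g (of_real r * exp (\<i> * of_real \<theta>))) * \<phi> \<theta>)
        absolutely_integrable_on {0..2*pi} \<and>
      circle_pairing f \<phi> r + circle_pairing g \<phi> r = circle_pairing (\<lambda>z. f z + g z) \<phi> r"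
  proof eventually_elim
    case (elim r)
    then show ?case
      unfolding circle_pairing_def distrib_right
      by (auto intro!: set_integral_add(1) integral_add[symmetric] set_lebesgue_integral_eq_integral(1))
  qed
  then show "\<forall>\<^sub>F r in at_left 1.
      (\<lambda>\<theta>. (f (of_real r * exp (\<i> * of_real \<theta>)) + g (of_real r * exp (\<i> * of_real \<theta>))) * \<phi> \<theta>)
        absolutely_integrable_on {0..2*pi}"
    by eventually_elim simp
  have "((\<lambda>r. circle_pairing f \<phi> r + circle_pairing g \<phi> r) \<longlongrightarrow> u \<phi> + v \<phi>) (at_left 1)"
    using assms \<phi> by (intro tendsto_add) (auto simp: has_bv_def)
  moreover from ev have "\<forall>\<^sub>F r in at_left 1.
      circle_pairing f \<phi> r + circle_pairing g \<phi> r = circle_pairing (\<lambda>z. f z + g z) \<phi> r"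
    by eventually_elim simp
  ultimately show "(circle_pairing (\<lambda>z. f z + g z) \<phi> \<longlongrightarrow> u \<phi> + v \<phi>) (at_left 1)"
    by (rule Lim_transform_eventually)
qed

lemma absolutely_integrable_on_cmult:
  fixes f :: "real \<Rightarrow> complex"
  assumes "f absolutely_integrable_on S"
  shows "(\<lambda>x. b * f x) absolutely_integrable_on S"
  using absolutely_integrable_linear[OF assms bounded_linear_mult_right] by (simp add: o_def)

lemma has_bv_cmult:
  assumes "has_bv f u"
  shows "has_bv (\<lambda>z. b * f z) (\<lambda>\<phi>. b * u \<phi>)"
proof -
  have "circle_pairing (\<lambda>z. b * f z) \<phi> = (\<lambda>r. b * circle_pairing f \<phi> r)" for \<phi>
    by (simp add: circle_pairing_def mult.assoc fun_eq_iff)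
  then show ?thesis
    using assms
    by (auto simp: has_bv_def mult.assoc elim!: eventually_mono
        intro!: tendsto_mult_left absolutely_integrable_on_cmult)
qed

lemma has_bv_sum:
  assumes "finite A" "\<And>x. x \<in> A \<Longrightarrow> has_bv (f x) (u x)"
  shows "has_bv (\<lambda>z. \<Sum>x\<in>A. f x z) (\<lambda>\<phi>. \<Sum>x\<in>A. u x \<phi>)"
  using assms
proof (induction A rule: finite_induct)
  case empty
  show ?case by (simp add: has_bv_def circle_pairing_def[abs_def])
next
  case (insert x A)
  then show ?case by (auto intro!: has_bv_add)
qed

text \<open>On the circle of radius r the extra factor is r^l exp(-i l theta): the exponential moves
  to the test function, and r^l tends to 1.\<close>

lemma has_bv_cnj_power_mult:
  assumes "has_bv f u"
  shows "has_bv (\<lambda>z. cnj z ^ l * f z) (distr_mult (\<lambda>t. cis (- real l * t)) u)"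
  unfolding has_bv_def
proof (intro ballI conjI)
  fix \<phi> :: "real \<Rightarrow> complex" assume "\<phi> \<in> circle_test"
  define \<psi> where "\<psi> = (\<lambda>t. cis (- real l * t) * \<phi> t)"
  have \<psi>: "\<psi> \<in> circle_test"
    unfolding \<psi>_def by (rule circle_test_cis_mult[OF \<open>\<phi> \<in> circle_test\<close>]) auto
  have "cnj (of_real r * exp (\<i> * of_real \<theta>)) ^ l = of_real r ^ l * cis (- real l * \<theta>)" for r \<theta>
    by (simp add: power_mult_distrib cis_cnj Complex.DeMoivre flip: cis_conv_exp)
  then have eq: "cnj (of_real r * exp (\<i> * of_real \<theta>)) ^ l * f (of_real r * exp (\<i> * of_real \<theta>)) * \<phi> \<theta> =
      of_real r ^ l * (f (of_real r * exp (\<i> * of_real \<theta>)) * \<psi> \<theta>)" for r \<theta>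
    by (simp only: \<psi>_def mult_ac)
  have "\<forall>\<^sub>F r in at_left 1.
      (\<lambda>\<theta>. f (of_real r * exp (\<i> * of_real \<theta>)) * \<psi> \<theta>) absolutely_integrable_on {0..2*pi}"
    using assms \<psi> by (simp add: has_bv_def)
  then show "\<forall>\<^sub>F r in at_left 1.
      (\<lambda>\<theta>. cnj (of_real r * exp (\<i> * of_real \<theta>)) ^ l * f (of_real r * exp (\<i> * of_real \<theta>)) * \<phi> \<theta>)
        absolutely_integrable_on {0..2*pi}"
    unfolding eq by eventually_elim (rule absolutely_integrable_on_cmult)
  have "circle_pairing (\<lambda>z. cnj z ^ l * f z) \<phi> = (\<lambda>r. of_real r ^ l * circle_pairing f \<psi> r)"
    unfolding circle_pairing_def eq by simp
  moreover have "((\<lambda>r. of_real r ^ l * circle_pairing f \<psi> r) \<longlongrightarrow> of_real 1 ^ l * u \<psi>) (at_left 1)"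
    using assms \<psi> by (intro tendsto_intros) (auto simp: has_bv_def)
  ultimately show "(circle_pairing (\<lambda>z. cnj z ^ l * f z) \<phi> \<longlongrightarrow>
      distr_mult (\<lambda>t. cis (- real l * t)) u \<phi>) (at_left 1)"
    by (simp add: distr_mult_def \<psi>_def)
qed

lemma has_bv_const: "has_bv (\<lambda>z. b) (\<lambda>\<phi>. b * integral {0..2*pi} \<phi>)"
  using absolutely_integrable_on_cmult[OF absolutely_integrable_continuous_real[OF continuous_on_circle_test]]
  by (simp add: has_bv_def circle_pairing_def[abs_def])

text \<open>Makes the functional sending \<open>\<phi>\<close> to b times its integral a
  distribution as a special case of boundary values, without a separate estimate.\<close>

lemma const_in_H_b: "(\<lambda>z. b) \<in> H_b"
  using has_bvD(1)[OF has_bv_const] by (simp add: H_b_def)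

section \<open>Boundary values as distributions and their real parts\<close>

lemma boundary_value_in_circle_distributions:
  assumes "h \<in> H_b"
  shows "boundary_value h \<in> circle_distributions"
proof -
  have h: "has_boundary_value h" using assms by (simp add: H_b_def)
  note lim = has_boundary_value_tendsto[OF h]
  have cont: "continuous_on {0..2*pi} (\<lambda>\<theta>. h (of_real r * exp (\<i> * of_real \<theta>)) * \<phi> \<theta>)"
    if "\<phi> \<in> circle_test" "0 < r \<and> r < 1" for \<phi> r
  proof (rule continuous_on_mult[OF _ continuous_on_circle_test[OF that(1)]])
    have "continuous_on (ball 0 1) h"
      using assms by (auto simp: H_b_def intro: holomorphic_on_imp_continuous_on)
    then show "continuous_on {0..2*pi} (\<lambda>\<theta>. h (of_real r * exp (\<i> * of_real \<theta>)))"
      by (rule continuous_on_compose2) (use that(2) in \<open>auto intro!: continuous_intros simp: norm_mult\<close>)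
  qed
  obtain K N where K: "\<And>\<phi> r. \<phi> \<in> circle_test \<Longrightarrow> 0 \<le> r \<Longrightarrow> r < 1 \<Longrightarrow>
      cmod (circle_pairing h \<phi> r) \<le> K * test_seminorm N \<phi>"
    using circle_pairing_bound[OF assms] by blast
  show ?thesis
  proof (rule circle_distributionsI[where C = K and N = N])
    fix \<phi> \<psi> assume \<phi>: "\<phi> \<in> circle_test" and \<psi>: "\<psi> \<in> circle_test"
    have "\<forall>\<^sub>F r in at_left 1. circle_pairing h \<phi> r + circle_pairing h \<psi> r = circle_pairing h (\<lambda>t. \<phi> t + \<psi> t) r"
      using eventually_at_left_1_pos
      by eventually_elim (simp add: circle_pairing_def distrib_left integral_add integrable_continuous_real cont \<phi> \<psi>)
    from tendsto_unique[OF trivial_limit_at_left_real lim[OF circle_test_add[OF \<phi> \<psi>]]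
        Lim_transform_eventually[OF tendsto_add[OF lim[OF \<phi>] lim[OF \<psi>]] this]]
    show "boundary_value h (\<lambda>t. \<phi> t + \<psi> t) = boundary_value h \<phi> + boundary_value h \<psi>" .
  next
    fix \<phi> b assume \<phi>: "\<phi> \<in> circle_test"
    have "circle_pairing h (\<lambda>t. b * \<phi> t) = (\<lambda>r. b * circle_pairing h \<phi> r)"
      by (simp add: circle_pairing_def mult.left_commute[of _ b] fun_eq_iff)
    with lim[OF circle_test_cmult[OF \<phi>, of b]] tendsto_mult_left[OF lim[OF \<phi>], of b]
    show "boundary_value h (\<lambda>t. b * \<phi> t) = b * boundary_value h \<phi>"
      using tendsto_unique[OF trivial_limit_at_left_real] by metis
  next
    fix \<phi> assume \<phi>: "\<phi> \<in> circle_test"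
    show "cmod (boundary_value h \<phi>) \<le> K * test_seminorm N \<phi>"
      by (rule Lim_norm_ubound[OF trivial_limit_at_left_real lim[OF \<phi>]])
        (use eventually_at_left_1_pos K[OF \<phi>] in \<open>auto elim!: eventually_mono\<close>)
  qed
qed

text \<open>\<open>distr_Re\<close> is assembled from values at the real-valued functions Re
  \<open>\<phi>\<close> and Im \<open>\<phi>\<close>, which are again test functions.\<close>

lemma distr_eq_distr_ReI:
  assumes "\<And>\<psi>. (\<lambda>t. of_real (\<psi> t)) \<in> circle_test \<Longrightarrow> Re (u (\<lambda>t. of_real (\<psi> t))) = Re (v (\<lambda>t. of_real (\<psi> t)))"
  shows "distr_eq (distr_Re u) (distr_Re v)"
  unfolding distr_eq_def distr_Re_def
  using assms[of "\<lambda>t. Re (_ t)", OF circle_test_Re] assms[of "\<lambda>t. Im (_ t)", OF circle_test_Im] by simp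

subsection \<open>Poisson integrals of boundary values\<close>

text \<open>With w = z exp(-i t) the two geometric series add up to 1/(1 - w) + 1/(1 - conj w) - 1 =
  (1 - |w|^2) / |1 - w|^2.\<close>

lemma poisson_kernel_series:
  assumes "cmod z < 1"
  shows "(\<lambda>t. complex_of_real (poisson_kernel (cmod z) (Arg z - t))) =
    (\<lambda>t. (\<Sum>k. z ^ k * cis (- real k * t)) + (\<Sum>k. (if k = 0 then 0 else cnj z ^ k) * cis (real k * t)))"
proof
  fix t
  define w where "w = z * cis (- t)"
  have w: "cmod w < 1" using assms by (simp add: w_def norm_mult)
  have "z ^ k * cis (- real k * t) = w ^ k" for k
    by (simp add: w_def power_mult_distrib Complex.DeMoivre)
  then have 1: "(\<Sum>k. z ^ k * cis (- real k * t)) = 1 / (1 - w)"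
    using suminf_geometric[OF w] by simp
  have "cnj z ^ k * cis (real k * t) = cnj w ^ k" for k
    by (simp add: w_def power_mult_distrib Complex.DeMoivre cis_cnj)
  \<comment> \<open>Frequency 0 already occurs in the first series, so the second is a geometric
    series with its initial 1 subtracted.\<close>
  then have "(\<lambda>k. (if k = 0 then 0 else cnj z ^ k) * cis (real k * t)) =
      (\<lambda>k. cnj w ^ k - (if k = 0 then 1 else 0))"
    by (auto simp: fun_eq_iff)
  moreover have "(\<lambda>k. cnj w ^ k - (if k = 0 then 1 else 0)) sums (1 / (1 - cnj w) - 1)"
    using w by (intro sums_diff geometric_sums sums_single[of 0 "\<lambda>_. 1"]) auto
  ultimately have 2: "(\<Sum>k. (if k = 0 then 0 else cnj z ^ k) * cis (real k * t)) = 1 / (1 - cnj w) - 1"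
    by (simp add: sums_iff)
  have nz: "1 - w \<noteq> 0" "1 - cnj w \<noteq> 0" using w by auto
  have z: "z = of_real (cmod z) * cis (Arg z)"
    using rcis_cmod_Arg[of z] by (simp add: rcis_def)
  have "w = of_real (cmod z) * cis (Arg z - t)"
    by (subst w_def, subst z) (simp add: cis_mult)
  then have re: "Re w = cmod z * cos (Arg z - t)" by simp
  have "cmod w = cmod z" by (simp add: w_def norm_mult)
  then have norm: "w * cnj w = of_real ((cmod z)\<^sup>2)"
    using complex_norm_square[of w] by simp
  have sum: "w + cnj w = of_real (2 * cmod z * cos (Arg z - t))"
    by (simp add: complex_add_cnj re)
  have den: "(1 - w) * (1 - cnj w) = of_real (1 - 2 * cmod z * cos (Arg z - t) + (cmod z)\<^sup>2)"
  proof -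
    have "(1 - w) * (1 - cnj w) = 1 - (w + cnj w) + w * cnj w" by (simp add: algebra_simps)
    then show ?thesis unfolding norm sum by simp
  qed
  have "1 / (1 - w) + (1 / (1 - cnj w) - 1) = (1 - w * cnj w) / ((1 - w) * (1 - cnj w))"
    using nz by (simp add: field_simps)
  also have "\<dots> = complex_of_real (poisson_kernel (cmod z) (Arg z - t))"
    unfolding den norm poisson_kernel_def by simp
  finally show "complex_of_real (poisson_kernel (cmod z) (Arg z - t)) =
      (\<Sum>k. z ^ k * cis (- real k * t)) + (\<Sum>k. (if k = 0 then 0 else cnj z ^ k) * cis (real k * t))"
    unfolding 1 2 by simp
qed

lemma summable_power_mult_geometric:
  fixes x :: real
  assumes "0 \<le> x" "x < 1"
  shows "summable (\<lambda>m. real m ^ k * x ^ m)"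
proof (cases "x = 0")
  case True
  then show ?thesis by (intro summable_finite[of "{0}"]) auto
next
  case False
  with assms have x: "0 < x" "x < 1" by auto
  \<comment> \<open>The ratio (1 + x) / 2 lies strictly between x and 1, and the gap absorbs the
    polynomial factor.\<close>
  have "(\<lambda>m. real m ^ k * x ^ m) \<in> O(\<lambda>m. ((1 + x) / 2) ^ m)"
    using x by real_asymp
  then show ?thesis
    by (rule summable_comparison_test_bigo[rotated]) (use x in \<open>simp add: summable_geometric norm_power\<close>)
qed

lemma boundary_value_poisson_kernel:
  fixes h :: "complex \<Rightarrow> complex"
  assumes h: "h \<in> H_b" and z: "cmod z < 1"
  shows "boundary_value h (\<lambda>t. of_real (poisson_kernel (cmod z) (Arg z - t))) = 2 * pi * h z"
proof -
  define p q where "p = (\<lambda>t. \<Sum>k. z ^ k * cis (- real k * t))"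
    and "q = (\<lambda>t. \<Sum>k. (if k = 0 then 0 else cnj z ^ k) * cis (real k * t))"
  have sp: "summable (\<lambda>m. real m ^ k * cmod (z ^ m))" for k
    using summable_power_mult_geometric[OF norm_ge_zero z] by (simp add: norm_power)
  have sq: "summable (\<lambda>m. real m ^ k * cmod (if m = 0 then 0 else cnj z ^ m))" for k
    by (rule summable_comparison_test_ev[OF _ sp[of k]])
      (intro always_eventually allI, simp add: norm_power)
  \<comment> \<open>Boundary values are controlled on test functions only, so both halves of the
    kernel have to be smooth and periodic.\<close>
  have p: "p \<in> circle_test"
    unfolding p_def by (rule cis_series_in_circle_test[OF sp]) auto
  have q: "q \<in> circle_test"
    unfolding q_def by (rule cis_series_in_circle_test[OF sq]) auto
  have eq: "(\<lambda>t. of_real (poisson_kernel (cmod z) (Arg z - t))) = (\<lambda>t. p t + q t)"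
    unfolding p_def q_def by (rule poisson_kernel_series[OF z])
  have pq: "(\<lambda>t. p t + q t) \<in> circle_test" by (rule circle_test_add[OF p q])
  have F: "fourier (\<lambda>t. p t + q t) m = 2 * pi * z ^ m" for m
  proof -
    have "fourier p m = 2 * pi * z ^ m"
      unfolding p_def using sp[of 0] by (intro fourier_cis_series_neg) simp
    moreover have "fourier q m = 0"
      unfolding q_def using sq[of 0] by (intro fourier_cis_series_pos) auto
    ultimately show ?thesis by (simp add: fourier_add[OF p q])
  qed
  have hol: "h holomorphic_on ball 0 1" and bv: "has_boundary_value h"
    using h by (auto simp: H_b_def)
  \<comment> \<open>At radius r the pairing with the kernel is exactly 2 pi h(r z); continuity of h
    at z then gives the limit.\<close>
  have "\<forall>\<^sub>F r in at_left 1. 2 * pi * h (of_real r * z) = circle_pairing h (\<lambda>t. p t + q t) r"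
    using eventually_at_left_1_pos
  proof eventually_elim
    case (elim r)
    have "cmod (of_real r * z) < 1"
      using elim z mult_right_mono[of r 1 "cmod z"] by (simp add: norm_mult)
    from sums_mult[OF taylor_sums[OF hol this], of "2 * pi"]
    have "(\<lambda>m. taylor_coeff h m * of_real r ^ m * (2 * pi * z ^ m)) sums (2 * pi * h (of_real r * z))"
      by (simp add: power_mult_distrib mult_ac)
    moreover have "(\<lambda>m. taylor_coeff h m * of_real r ^ m * (2 * pi * z ^ m)) sums
        circle_pairing h (\<lambda>t. p t + q t) r"
      unfolding F[symmetric]
      by (rule circle_pairing_sums[OF hol continuous_on_circle_test[OF pq]]) (use elim in auto)
    ultimately show ?case by (rule sums_unique2)
  qed
  moreover have "((\<lambda>r. 2 * pi * h (of_real r * z)) \<longlongrightarrow> 2 * pi * h (of_real 1 * z)) (at_left 1)"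
  proof (intro tendsto_mult_left)
    have "isCont h z"
      using z holomorphic_on_imp_continuous_on[OF hol] by (simp add: continuous_on_eq_continuous_at)
    then show "((\<lambda>r. h (of_real r * z)) \<longlongrightarrow> h (of_real 1 * z)) (at_left 1)"
      by (intro isCont_tendsto_compose[where g = h]) (auto intro!: tendsto_intros tendsto_eq_intros)
  qed
  ultimately have "(circle_pairing h (\<lambda>t. p t + q t) \<longlongrightarrow> 2 * pi * h z) (at_left 1)"
    using Lim_transform_eventually by fastforce
  from tendsto_unique[OF trivial_limit_at_left_real has_boundary_value_tendsto[OF bv pq] this]
  show ?thesis unfolding eq .
qed

text \<open>At z = 0 the Poisson kernel is the constant 1, so the pairing with 1 is given by the
  value of h at the centre.\<close>

lemma I_const_eq:
  assumes "h \<in> H_b"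
  shows "I_const h = \<i> * of_real (Im (h 0))"
proof -
  have "boundary_value h (\<lambda>t. 1) = 2 * pi * h 0"
    using boundary_value_poisson_kernel[OF assms, of 0] by (simp add: poisson_kernel_def)
  \<comment> \<open>\<open>distr_Im\<close> also evaluates the functional at the imaginary part of
    the constant 1, the zero function.\<close>
  moreover have "boundary_value h (\<lambda>t. 0) = 0"
    using circle_distributions_cmult_fun[OF boundary_value_in_circle_distributions[OF assms] circle_test_const, of 0]
    by simp
  ultimately show ?thesis by (simp add: I_const_def distr_Im_def)
qed

lemma schwarz_fun_Suc_eq:
  assumes "h k \<in> H_b" "cmod z < 1"
  shows "schwarz_fun h c (Suc k) z = h k z + \<i> * of_real (c k - Im (h k 0))
    - (\<Sum>l=1..k. (-1) ^ l / fact l * cnj z ^ l * schwarz_fun h c (Suc k - l) z)"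
  using boundary_value_poisson_kernel[OF assms] I_const_eq[OF assms(1)]
  by (simp add: algebra_simps)

subsection \<open>The conjugate derivative\<close>

text \<open>The value of \<open>dbar\<close> is meaningful only at points of real differentiability,
  so the calculus rules carry differentiability along.\<close>

definition has_dbar :: "(complex \<Rightarrow> complex) \<Rightarrow> complex \<Rightarrow> complex \<Rightarrow> bool" where
  "has_dbar f d z \<longleftrightarrow> f differentiable (at z) \<and> dbar f z = d"

lemma has_dbarI:
  assumes "(f has_derivative A) (at z)" "(A 1 + \<i> * A \<i>) / 2 = d"
  shows "has_dbar f d z"
  using assms frechet_derivative_at[OF assms(1)]
  by (auto simp: has_dbar_def dbar_def differentiable_def)

lemma has_dbarE:
  assumes "has_dbar f d z"
  obtains A where "(f has_derivative A) (at z)" "(A 1 + \<i> * A \<i>) / 2 = d"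
  using assms by (auto simp: has_dbar_def dbar_def frechet_derivative_works)

lemma has_dbar_cong:
  assumes "has_dbar f d z" "open S" "z \<in> S" "\<And>w. w \<in> S \<Longrightarrow> f w = g w"
  shows "has_dbar g d z"
proof -
  obtain A where A: "(f has_derivative A) (at z)" "(A 1 + \<i> * A \<i>) / 2 = d"
    using assms(1) by (rule has_dbarE)
  show ?thesis
    by (rule has_dbarI[OF has_derivative_transform_within_open[OF A(1) assms(2,3,4)] A(2)])
qed

text \<open>The Frechet derivative is multiplication by a complex number f', and f' + i (i f') =
  0.\<close>

lemma has_dbar_holomorphic:
  assumes "f holomorphic_on S" "open S" "z \<in> S"
  shows "has_dbar f 0 z"
proof -
  obtain f' where "(f has_field_derivative f') (at z)"
    using assms by (auto simp: holomorphic_on_open)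
  then show ?thesis
    by (intro has_dbarI[of f "\<lambda>h. f' * h"])
      (auto simp: has_field_derivative_def mult.left_commute[of \<i> f' \<i>])
qed

lemma has_dbar_add:
  assumes "has_dbar f d z" "has_dbar g e z"
  shows "has_dbar (\<lambda>z. f z + g z) (d + e) z"
proof -
  obtain A where A: "(f has_derivative A) (at z)" "(A 1 + \<i> * A \<i>) / 2 = d"
    using assms(1) by (rule has_dbarE)
  obtain B where B: "(g has_derivative B) (at z)" "(B 1 + \<i> * B \<i>) / 2 = e"
    using assms(2) by (rule has_dbarE)
  show ?thesis
    by (rule has_dbarI[OF has_derivative_add[OF A(1) B(1)]])
      (simp add: A(2)[symmetric] B(2)[symmetric] field_simps)
qed

lemma has_dbar_mult:
  assumes "has_dbar f d z" "has_dbar g e z"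
  shows "has_dbar (\<lambda>z. f z * g z) (d * g z + f z * e) z"
proof -
  obtain A where A: "(f has_derivative A) (at z)" "(A 1 + \<i> * A \<i>) / 2 = d"
    using assms(1) by (rule has_dbarE)
  obtain B where B: "(g has_derivative B) (at z)" "(B 1 + \<i> * B \<i>) / 2 = e"
    using assms(2) by (rule has_dbarE)
  show ?thesis
    by (rule has_dbarI[OF has_derivative_mult[OF A(1) B(1)]])
      (simp add: A(2)[symmetric] B(2)[symmetric] field_simps)
qed

lemma has_dbar_const: "has_dbar (\<lambda>z. b) 0 z"
  by (rule has_dbarI[OF has_derivative_const]) simp

lemma has_dbar_cmult: "has_dbar f d z \<Longrightarrow> has_dbar (\<lambda>z. b * f z) (b * d) z"
  using has_dbar_mult[OF has_dbar_const] by fastforce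

lemma has_dbar_diff:
  assumes "has_dbar f d z" "has_dbar g e z"
  shows "has_dbar (\<lambda>z. f z - g z) (d - e) z"
  using has_dbar_add[OF assms(1) has_dbar_cmult[OF assms(2), of "-1"]] by simp

lemma has_dbar_sum:
  assumes "finite A" "\<And>x. x \<in> A \<Longrightarrow> has_dbar (f x) (d x) z"
  shows "has_dbar (\<lambda>z. \<Sum>x\<in>A. f x z) (\<Sum>x\<in>A. d x) z"
  using assms
proof (induction A rule: finite_induct)
  case empty
  show ?case by (simp add: has_dbar_const)
next
  case (insert x A)
  then show ?case by (auto intro!: has_dbar_add)
qed

lemma has_dbar_cnj_power: "has_dbar (\<lambda>z. cnj z ^ l) (of_nat l * cnj z ^ (l - 1)) z"
proof (induction l)
  case 0
  show ?case by (simp add: has_dbar_const)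
next
  case (Suc l)
  have "has_dbar cnj 1 z"
    by (rule has_dbarI[OF bounded_linear_imp_has_derivative[OF bounded_linear_cnj]]) simp
  from has_dbar_mult[OF this Suc.IH] show ?case
    by (cases l) (simp_all add: algebra_simps)
qed

subsection \<open>The Schwarz problem\<close>

text \<open>The product rule splits the derivative of the correction sum into two sums that cancel
  up to the term f_{k-1}. At k = 0 the truncated index k - 1 is again 0, consistent with f_0 =
  0.\<close>

lemma has_dbar_schwarz_fun:
  assumes "\<And>j. j < k \<Longrightarrow> h j \<in> H_b" "z \<in> ball 0 1"
  shows "has_dbar (schwarz_fun h c k) (schwarz_fun h c (k - 1) z) z"
  using assms
proof (induction k arbitrary: z rule: less_induct)
  case (less k)
  show ?case
  proof (cases k)
    case 0
    then show ?thesis by (simp add: has_dbar_const)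
  next
    case (Suc k')
    let ?f = "schwarz_fun h c"
    define e where "e l = (-1) ^ l / fact l * cnj z ^ l" for l :: nat
    define g where "g w = h k' w + \<i> * of_real (c k' - Im (h k' 0))" for w
    have "has_dbar (\<lambda>w. g w - (\<Sum>l=1..k'. (-1) ^ l / fact l * (cnj w ^ l * ?f (Suc k' - l) w)))
        (0 - (\<Sum>l=1..k'. (-1) ^ l / fact l *
          (of_nat l * cnj z ^ (l - 1) * ?f (Suc k' - l) z + cnj z ^ l * ?f (Suc k' - l - 1) z))) z"
    proof (intro has_dbar_diff has_dbar_sum has_dbar_cmult has_dbar_mult has_dbar_cnj_power)
      have "g holomorphic_on ball 0 1"
        unfolding g_def using less.prems(1)[of k'] Suc by (auto simp: H_b_def intro!: holomorphic_intros)
      then show "has_dbar g 0 z"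
        using less.prems(2) by (rule has_dbar_holomorphic[OF _ open_ball])
      show "has_dbar (?f (Suc k' - l)) (?f (Suc k' - l - 1) z) z" if "l \<in> {1..k'}" for l
        using that Suc less.prems by (intro less.IH) auto
    qed auto
    moreover have "g w - (\<Sum>l=1..k'. (-1) ^ l / fact l * (cnj w ^ l * ?f (Suc k' - l) w)) = ?f (Suc k') w"
      if "w \<in> ball 0 1" for w
      using that less.prems(1)[of k'] Suc
      by (subst schwarz_fun_Suc_eq) (auto simp: g_def mult.assoc)
    moreover have "0 - (\<Sum>l=1..k'. (-1) ^ l / fact l *
        (of_nat l * cnj z ^ (l - 1) * ?f (Suc k' - l) z + cnj z ^ l * ?f (Suc k' - l - 1) z)) = ?f k' z"
    proof (cases k')
      case (Suc m)
      \<comment> \<open>Differentiating the coefficient of index l + 1 gives minus the coefficient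
        of index l; the factorials and signs are chosen for this.\<close>
      have coeff: "(-1) ^ Suc l / fact (Suc l) * (of_nat (Suc l) * cnj z ^ (Suc l - Suc 0)) = - e l" for l
        unfolding e_def fact_Suc using of_nat_neq_0[of l, where 'a = complex]
        by (simp add: field_simps del: of_nat_Suc)
      have "(\<Sum>l=1..k'. (-1) ^ l / fact l *
          (of_nat l * cnj z ^ (l - 1) * ?f (Suc k' - l) z + cnj z ^ l * ?f (Suc k' - l - 1) z)) =
          (\<Sum>l=1..k'. (-1) ^ l / fact l * (of_nat l * cnj z ^ (l - 1)) * ?f (Suc k' - l) z)
          + (\<Sum>l=1..k'. e l * ?f (k' - l) z)"
        by (simp add: e_def distrib_left mult.assoc flip: sum.distrib)
      also have "(\<Sum>l=1..k'. (-1) ^ l / fact l * (of_nat l * cnj z ^ (l - 1)) * ?f (Suc k' - l) z)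
          = (\<Sum>l=0..m. - e l * ?f (k' - l) z)"
        unfolding Suc One_nat_def sum.shift_bounds_cl_Suc_ivl coeff by (simp del: schwarz_fun.simps)
      \<comment> \<open>The term l = 0 has no partner in the other sum; it is the desired
        derivative.\<close>
      also have "\<dots> = - ?f k' z - (\<Sum>l=1..m. e l * ?f (k' - l) z)"
        by (subst sum.atLeast_Suc_atMost) (simp_all add: e_def sum_negf del: schwarz_fun.simps)
      \<comment> \<open>The top term l = k' contains f_0 = 0.\<close>
      also have "(\<Sum>l=1..k'. e l * ?f (k' - l) z) = (\<Sum>l=1..m. e l * ?f (k' - l) z)"
        unfolding Suc by simp
      finally show ?thesis by simp
    qed simp
    ultimately show ?thesis
      unfolding Suc using less.prems(2) has_dbar_cong[OF _ open_ball, of _ _ z 0 1 "?f (Suc k')"]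
      by (simp del: schwarz_fun.simps)
  qed
qed

text \<open>The boundary value of f_k is a finite combination of that of h_{k-1}, an integral and
  earlier ones times characters, so existence and continuity must be available for all smaller
  indices.\<close>

lemma schwarz_fun_boundary_value:
  assumes "\<And>j. j < k \<Longrightarrow> h j \<in> H_b" "k \<ge> 1"
  shows "has_boundary_value (schwarz_fun h c k) \<and>
    boundary_value (schwarz_fun h c k) \<in> circle_distributions \<and>
    distr_eq (distr_Re (boundary_value (schwarz_fun h c k)))
      (distr_Re (\<lambda>\<phi>. boundary_value (h (k - 1)) \<phi>
         - (\<Sum>l=1..k-1. (-1) ^ l / fact l *
              distr_mult (\<lambda>t. exp (- \<i> * of_nat l * of_real t)) (boundary_value (schwarz_fun h c (k - l))) \<phi>)))"
  using assms
proof (induction k rule: less_induct)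
  case (less k)
  obtain k' where k: "k = Suc k'" using less.prems(2) by (cases k) auto
  let ?f = "schwarz_fun h c"
  define \<kappa> where "\<kappa> = c k' - Im (h k' 0)"
  define s where "s = (\<lambda>\<phi>. \<Sum>l=1..k'. (-1) ^ l / fact l *
    distr_mult (\<lambda>t. cis (- real l * t)) (boundary_value (?f (k - l))) \<phi>)"
  \<comment> \<open>The explicit candidate for the boundary value; subtraction is written as adding
    a multiple by -1 to fit the rules for sums and multiples.\<close>
  define u where "u = (\<lambda>\<phi>. (boundary_value (h k') \<phi> + \<i> * of_real \<kappa> * integral {0..2*pi} \<phi>) + (-1) * s \<phi>)"
  have h: "h k' \<in> H_b" using less.prems(1) k by simp
  have IH: "has_boundary_value (?f (k - l))" "boundary_value (?f (k - l)) \<in> circle_distributions"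
    if "l \<in> {1..k'}" for l
    using less.IH[of "k - l"] less.prems(1) that k by auto
  have "has_bv (\<lambda>z. (h k' z + \<i> * of_real \<kappa>)
      + (-1) * (\<Sum>l=1..k'. (-1) ^ l / fact l * (cnj z ^ l * ?f (k - l) z))) u"
    unfolding u_def s_def using IH h
    by (intro has_bv_add has_bv_cmult has_bv_sum has_bv_cnj_power_mult has_bv_const has_bv_boundary_value)
      (auto simp: H_b_def)
  then have bv: "has_bv (?f k) u"
    by (rule has_bv_cong) (use h in \<open>simp add: k schwarz_fun_Suc_eq \<kappa>_def mult.assoc del: schwarz_fun.simps\<close>)
  have const: "(\<lambda>\<phi>. \<i> * of_real \<kappa> * integral {0..2*pi} \<phi>) \<in> circle_distributions"
    by (rule circle_distributions_cong[OF boundary_value_in_circle_distributions[OF const_in_H_b]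
          has_bvD(2)[OF has_bv_const]])
  have u: "u \<in> circle_distributions"
    unfolding u_def s_def
    by (intro circle_distributions_add circle_distributions_cmult circle_distributions_sum
        distr_mult_cis_in_circle_distributions boundary_value_in_circle_distributions[OF h] const IH)
      auto
  have "distr_eq u (boundary_value (?f k))"
    using has_bvD(2)[OF bv] by (simp add: distr_eq_def)
  then have "boundary_value (?f k) \<in> circle_distributions"
    by (rule circle_distributions_cong[OF u])
  moreover have "distr_eq (distr_Re (boundary_value (?f k))) (distr_Re (\<lambda>\<phi>. boundary_value (h k') \<phi> - s \<phi>))"
  proof (rule distr_eq_distr_ReI)
    fix \<psi> :: "real \<Rightarrow> real" assume \<psi>: "(\<lambda>t. of_real (\<psi> t)) \<in> circle_test"
    \<comment> \<open>Hence the term with \<open>\<kappa>\<close> is purely imaginary at real-valued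
      test functions and drops out of the real part.\<close>
    have "Im (integral {0..2*pi} (\<lambda>t. complex_of_real (\<psi> t))) = 0"
      using integral_linear[OF integrable_continuous_real[OF continuous_on_circle_test[OF \<psi>]] bounded_linear_Im, of 0 "2 * pi"]
      by (simp add: o_def)
    moreover have "boundary_value (?f k) (\<lambda>t. of_real (\<psi> t)) = u (\<lambda>t. of_real (\<psi> t))"
      using has_bvD(2)[OF bv] \<psi> by (simp add: distr_eq_def)
    ultimately show "Re (boundary_value (?f k) (\<lambda>t. of_real (\<psi> t))) =
        Re (boundary_value (h k') (\<lambda>t. of_real (\<psi> t)) - s (\<lambda>t. of_real (\<psi> t)))"
      by (simp add: u_def)
  qed
  moreover have "(\<lambda>t. exp (- \<i> * of_nat l * of_real t)) = (\<lambda>t. cis (- real l * t))" for l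
    by (simp add: cis_conv_exp mult.assoc)
  ultimately show ?case
    using has_bvD(1)[OF bv] by (simp add: k s_def del: schwarz_fun.simps)
qed

text \<open>At 0 every correction term has a factor conj 0 ^ l with l >= 1, and the added constant
  replaces the imaginary part of h(0) by the prescribed one.\<close>

lemma Im_schwarz_fun_0:
  assumes "h (k - 1) \<in> H_b" "k \<ge> 1"
  shows "Im (schwarz_fun h c k 0) = c (k - 1)"
proof -
  obtain k' where k: "k = Suc k'" using assms(2) by (cases k) auto
  have "(\<Sum>l=1..k'. (-1) ^ l / fact l * cnj 0 ^ l * schwarz_fun h c (Suc k' - l) 0) = 0"
    by (rule sum.neutral) (auto simp: power_0_left)
  then show ?thesis
    using assms(1) unfolding k by (subst schwarz_fun_Suc_eq) simp_all
qed

text \<open>The iterates are identified with f_{n-k} on the disk only; as the disk is open, this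
  determines the next derivative there.\<close>

lemma dbar_power_schwarz_fun:
  assumes "\<And>j. j < n \<Longrightarrow> h j \<in> H_b" "k \<le> n" "z \<in> ball 0 1"
  shows "(dbar ^^ k) (schwarz_fun h c n) z = schwarz_fun h c (n - k) z"
    and "has_dbar ((dbar ^^ k) (schwarz_fun h c n)) (schwarz_fun h c (n - k - 1) z) z"
proof -
  have dbar: "has_dbar F (schwarz_fun h c (m - 1) w) w"
    if "m \<le> n" "w \<in> ball 0 1" "\<And>w. w \<in> ball 0 1 \<Longrightarrow> F w = schwarz_fun h c m w" for F m w
  proof (rule has_dbar_cong[OF _ open_ball that(2)])
    show "has_dbar (schwarz_fun h c m) (schwarz_fun h c (m - 1) w) w"
      using that(1,2) assms(1) by (intro has_dbar_schwarz_fun) auto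
  qed (simp add: that(3))
  have *: "(dbar ^^ k) (schwarz_fun h c n) z = schwarz_fun h c (n - k) z" if "z \<in> ball 0 1" for z
    using assms(2) that
  proof (induction k arbitrary: z)
    case (Suc k)
    have "has_dbar ((dbar ^^ k) (schwarz_fun h c n)) (schwarz_fun h c (n - k - 1) z) z"
      using Suc by (intro dbar) auto
    then show ?case by (simp add: has_dbar_def)
  qed simp
  then show "(dbar ^^ k) (schwarz_fun h c n) z = schwarz_fun h c (n - k) z"
    using assms(3) by simp
  show "has_dbar ((dbar ^^ k) (schwarz_fun h c n)) (schwarz_fun h c (n - k - 1) z) z"
    by (rule dbar) (use assms(3) * in auto)
qed

text \<open>\<open>dbar\<close> and \<open>boundary_value\<close> are total functions, so the
  conclusion also asserts what makes them meaningful: differentiability of the iterates below order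
  \<open>n\<close>, and existence and continuity of the boundary values.\<close>

theorem theorem2p20:
  fixes n :: nat and h :: "nat \<Rightarrow> complex \<Rightarrow> complex" and c :: "nat \<Rightarrow> real"
    and f :: "nat \<Rightarrow> complex \<Rightarrow> complex"
  assumes n: "n \<ge> 1"
    and h: "\<And>j. j < n \<Longrightarrow> h j \<in> H_b"
    and f: "f = schwarz_fun h c"
  shows
    "(\<forall>k\<in>{1..n}.
        (\<forall>z\<in>ball 0 1. f k differentiable (at z) \<and> dbar (f k) z = f (k - 1) z) \<and>
        has_boundary_value (f k) \<and> boundary_value (f k) \<in> circle_distributions \<and>
        distr_eq (distr_Re (boundary_value (f k)))
          (distr_Re (\<lambda>\<phi>. boundary_value (h (k - 1)) \<phi>
             - (\<Sum>l=1..k-1. (-1) ^ l / fact l *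
                  distr_mult (\<lambda>t. exp (- \<i> * of_nat l * of_real t)) (boundary_value (f (k - l))) \<phi>))) \<and>
        Im (f k 0) = c (k - 1))
     \<and> (\<forall>z\<in>ball 0 1. (\<forall>k<n. (dbar ^^ k) (f n) differentiable (at z)) \<and> (dbar ^^ n) (f n) z = 0)
     \<and> (\<forall>k\<in>{0..n-1}.
        has_boundary_value ((dbar ^^ k) (f n)) \<and>
        boundary_value ((dbar ^^ k) (f n)) \<in> circle_distributions \<and>
        distr_eq (distr_Re (boundary_value ((dbar ^^ k) (f n)))) (distr_Re (boundary_value (f (n - k)))) \<and>
        distr_eq (distr_Re (boundary_value (f (n - k))))
          (distr_Re (\<lambda>\<phi>. boundary_value (h (n - 1 - k)) \<phi>
             - (\<Sum>l=1..n-k-1. (-1) ^ l / fact l *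
                  distr_mult (\<lambda>t. exp (- \<i> * of_nat l * of_real t)) (boundary_value (f (n - k - l))) \<phi>))) \<and>
        Im ((dbar ^^ k) (f n) 0) = c (n - 1 - k))"
proof (intro conjI ballI allI impI)
  fix k assume k: "k \<in> {1..n}"
  have "j < k \<Longrightarrow> h j \<in> H_b" for j using k by (intro h) auto
  then show "has_boundary_value (f k)" "boundary_value (f k) \<in> circle_distributions"
    "distr_eq (distr_Re (boundary_value (f k)))
          (distr_Re (\<lambda>\<phi>. boundary_value (h (k - 1)) \<phi>
             - (\<Sum>l=1..k-1. (-1) ^ l / fact l *
                  distr_mult (\<lambda>t. exp (- \<i> * of_nat l * of_real t)) (boundary_value (f (k - l))) \<phi>)))"
    unfolding f using schwarz_fun_boundary_value[of k h c] k by simp_all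
  show "Im (f k 0) = c (k - 1)"
    unfolding f using k h by (intro Im_schwarz_fun_0) auto
  fix z :: complex assume "z \<in> ball 0 1"
  then have "has_dbar (f k) (f (k - 1) z) z"
    unfolding f using k h by (intro has_dbar_schwarz_fun) auto
  then show "f k differentiable (at z)" "dbar (f k) z = f (k - 1) z"
    by (auto simp: has_dbar_def)
next
  fix z :: complex assume z: "z \<in> ball 0 1"
  show "(dbar ^^ k) (f n) differentiable (at z)" if "k < n" for k
    using dbar_power_schwarz_fun(2)[OF h less_imp_le[OF that] z] by (simp add: f has_dbar_def)
  show "(dbar ^^ n) (f n) z = 0"
    using dbar_power_schwarz_fun(1)[OF h order_refl z] by (simp add: f)
next
  fix k assume "k \<in> {0..n-1}"
  \<comment> \<open>The last equation reconciles the two ways in which the index of \<open>h\<close>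
    is written.\<close>
  then have k: "k \<le> n" "n - k \<ge> 1" "n - k - 1 = n - 1 - k" using n by auto
  have dbar: "(dbar ^^ k) (f n) z = f (n - k) z" if "z \<in> ball 0 1" for z
    unfolding f using h k(1) that by (rule dbar_power_schwarz_fun)
  have hk: "h j \<in> H_b" if "j < n - k" for j using that by (intro h) auto
  note bv = schwarz_fun_boundary_value[of "n - k" h c, OF hk k(2), folded f]
  \<comment> \<open>Boundary values see only the disk, where the iterate equals f_{n-k}.\<close>
  have has_bv: "has_bv ((dbar ^^ k) (f n)) (boundary_value (f (n - k)))"
    by (rule has_bv_cong[OF has_bv_boundary_value[OF conjunct1[OF bv]] dbar[symmetric]])
  have eq: "distr_eq (boundary_value ((dbar ^^ k) (f n))) (boundary_value (f (n - k)))"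
    by (rule has_bvD(2)[OF has_bv])
  show "has_boundary_value ((dbar ^^ k) (f n))"
    by (rule has_bvD(1)[OF has_bv])
  show "boundary_value ((dbar ^^ k) (f n)) \<in> circle_distributions"
    by (rule circle_distributions_cong[OF conjunct1[OF conjunct2[OF bv]] distr_eq_sym[OF eq]])
  show "distr_eq (distr_Re (boundary_value ((dbar ^^ k) (f n)))) (distr_Re (boundary_value (f (n - k))))"
    by (rule distr_eq_distr_ReI) (use eq in \<open>simp add: distr_eq_def\<close>)
  show "distr_eq (distr_Re (boundary_value (f (n - k))))
          (distr_Re (\<lambda>\<phi>. boundary_value (h (n - 1 - k)) \<phi>
             - (\<Sum>l=1..n-k-1. (-1) ^ l / fact l *
                  distr_mult (\<lambda>t. exp (- \<i> * of_nat l * of_real t)) (boundary_value (f (n - k - l))) \<phi>)))"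
    using bv unfolding k(3) by blast
  show "Im ((dbar ^^ k) (f n) 0) = c (n - 1 - k)"
    using Im_schwarz_fun_0[of h "n - k" c] h k dbar[of 0] by (simp add: f del: schwarz_fun.simps)
qed

end
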